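(* The subgroup $T=\langle t_v \mid v\in\{1,2,3\}^*\rangle$ of the mother group $G_3$ has finite decomposition complexity with respect to any proper length metric. More precisely, $T\in\mathcal{D}_\omega$, where $\omega$ is the first infinite ordinal.
   Context: Rooted trees. Let $X=\{1,2,3\}$, and let $X^*=\{1,2,3\}^*$ be the set of finite words over $X$ (including the empty word $\emptyset$), viewed as the vertex set of the 3-regular rooted tree $T_3$ with root $\emptyset$, where $w$ and $wx$ are joined by an edge for $w\in X^*$, $x\in X$. $\mathrm{Aut}(T_3)=\mathrm{Aut}(X^* )$ is the group of bijections of $X^*$ preserving the root and adjacency. For $g\in\mathrm{Aut}(X^* )$ and $v\in X^*$, the restriction $g|_v$ is defined by $g(vw)=g(v)\,g|_v(w)$ for all $w\in X^*$. One writes $g=(g|_1,g|_2,g|_3)\sigma$, where $\sigma\in S_3$ is the action of $g$ on the first level $X$ ($\sigma$ is omitted when trivial). Multiplication is $(g_1,g_2,g_3)\sigma\cdot(h_1,h_2,h_3)\tau=(g_1h_{\sigma(1)},g_2h_{\sigma(2)},g_3h_{\sigma(3)})\sigma\tau$; products of permutations and of automorphisms are read from left to right ($gh$ means first $g$, then $h$). Mother group $G_3$. Each $a\in S_3$ is regarded as the automorphism $a=(1,1,1)a$. Let $B_3=S_3\wr 2=S_3^2\rtimes S_2$; each $b=(b_1,b_2)\sigma\in B_3$ (with $b_1,b_2\in S_3$, $\sigma\in S_2$ acting on $\{1,2\}$ and extended to fix $3$) is regarded as the automorphism of $T_3$ defined recursively by $b=(b_1,b_2,b)\sigma$. $G_3$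 is the subgroup of $\mathrm{Aut}(T_3)$ generated by the images of $S_3$ and $B_3$. Elements $t_v$. Let $c\in G_3$ be defined recursively by $c=(1,(23),c)$, where $(23)\in S_3$ is the transposition, and let $t=(23)c(23)c=(1,c(23),(23)c)$. For $v\in\{1,2,3\}^*$ define $t_v$ inductively by $t_\emptyset=t$, $t_{1v}=(t_v,1,1)$, $t_{2v}=(1,t_v,1)$, $t_{3v}=(1,1,t_v)$. All $t_v$ belong to $G_3$. Metric. A length function $l$ on a group is proper if every ball $\{g:l(g)\le R\}$ is finite; it induces the (proper length) metric $d(g,h)=l(gh^{-1})$. Decomposition complexity. A family of subsets of a metric space is $r$-disjoint if any two distinct members $U,U'$ satisfy $\inf\{d(x,x'):x\in U,x'\in U'\}>r$. A metric family is a collection of metric spaces. A metric family $\mathcal{X}$ is $r$-decomposable over a metric family $\mathcal{Y}$, written $\mathcal{X}\stackrel{r}{\to}\mathcal{Y}$, if every $Z\in\mathcal{X}$ can be written as $Z=Z_0\cup Z_1$ where each $Z_i$ is the union of an $r$-disjoint family $\{Z_{ij}\}_j$ with all $Z_{ij}\in\mathcal{Y}$. $\mathcal{D}_0$ is the collection of bounded families (families whose members have uniformly bounded diameter), and for an ordinal $\alpha>0$, $\mathcal{D}_\alpha=\{\mathcal{X}:\forall r>0\ \exists\beta<\alpha\ \exists\mathcal{Y}\in\mathcal{D}_\beta\text{ with }\mathcal{X}\stackrel{r}{\to}\mathcal{Y}\}$. For a single metric space $Y$, $Y\in\mathcal{D}_\alpha$ means $\{Y\}\in\mathcal{D}_\alpha$;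 $Y$ has finite decomposition complexity if $Y\in\mathcal{D}_\alpha$ for some ordinal $\alpha$. *)

theory Defs
  imports "HOL-Analysis.Analysis" "HOL-Algebra.Generated_Groups"
begin

section \<open>The rooted tree and its automorphism group\<close>

datatype letter = L1 | L2 | L3

type_synonym word = "letter list"

definition tree_adjacent :: "word \<Rightarrow> word \<Rightarrow> bool" where
  "tree_adjacent u v \<longleftrightarrow> (\<exists>x. v = u @ [x] \<or> u = v @ [x])"

text \<open>Products are read from left to right, so \<open>g \<otimes> h\<close> is "first \<open>g\<close>, then \<open>h\<close>".\<close>

definition tree_aut :: "(word \<Rightarrow> word) monoid" where
  "tree_aut = \<lparr>carrier = {g. bij g \<and> g [] = [] \<and>
                  (\<forall>u v. tree_adjacent (g u) (g v) \<longleftrightarrow> tree_adjacent u v)},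
               mult = (\<lambda>g h. h \<circ> g), one = id\<rparr>"

text \<open>\<open>wreath f \<sigma>\<close> is \<open>(f 1, f 2, f 3)\<sigma>\<close>: it acts by \<open>\<sigma>\<close> on the first level and has
  restriction \<open>f x\<close> at the letter \<open>x\<close>.\<close>

primrec wreath :: "(letter \<Rightarrow> word \<Rightarrow> word) \<Rightarrow> (letter \<Rightarrow> letter) \<Rightarrow> word \<Rightarrow> word" where
  "wreath f \<sigma> [] = []"
| "wreath f \<sigma> (x # w) = \<sigma> x # f x w"

primrec triple :: "'b \<Rightarrow> 'b \<Rightarrow> 'b \<Rightarrow> letter \<Rightarrow> 'b" where
  "triple a b c L1 = a"
| "triple a b c L2 = b"
| "triple a b c L3 = c"

lemma wreath_mult:
  "wreath f \<sigma> \<otimes>\<^bsub>tree_aut\<^esub> wreath h \<tau>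
     = wreath (\<lambda>x. f x \<otimes>\<^bsub>tree_aut\<^esub> h (\<sigma> x)) (\<tau> \<circ> \<sigma>)"
proof
  fix w show "(wreath f \<sigma> \<otimes>\<^bsub>tree_aut\<^esub> wreath h \<tau>) w
     = wreath (\<lambda>x. f x \<otimes>\<^bsub>tree_aut\<^esub> h (\<sigma> x)) (\<tau> \<circ> \<sigma>) w"
    by (cases w) (auto simp: tree_aut_def)
qed


section \<open>The mother group\<close>

definition rooted :: "(letter \<Rightarrow> letter) \<Rightarrow> word \<Rightarrow> word" where
  "rooted a = wreath (\<lambda>_. id) a"

text \<open>The automorphism \<open>b = (b\<^sub>1, b\<^sub>2, b)\<sigma>\<close>, by recursion on the word it acts on; see
  \<open>directed_wreath\<close>.\<close>

primrec directed ::
    "(letter \<Rightarrow> letter) \<Rightarrow> (letter \<Rightarrow> letter) \<Rightarrow> (letter \<Rightarrow> letter) \<Rightarrow> word \<Rightarrow> word" where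
  "directed b1 b2 \<sigma> [] = []"
| "directed b1 b2 \<sigma> (x # w) = \<sigma> x # triple (rooted b1 w) (rooted b2 w) (directed b1 b2 \<sigma> w) x"

lemma directed_wreath:
  "directed b1 b2 \<sigma> = wreath (triple (rooted b1) (rooted b2) (directed b1 b2 \<sigma>)) \<sigma>"
proof
  fix w show "directed b1 b2 \<sigma> w
      = wreath (triple (rooted b1) (rooted b2) (directed b1 b2 \<sigma>)) \<sigma> w"
  proof (cases w)
    case (Cons x u) then show ?thesis by (cases x) auto
  qed simp
qed

definition mother_generators :: "(word \<Rightarrow> word) set" where
  "mother_generators =
     {rooted a | a. a permutes UNIV} \<union>
     {directed b1 b2 \<sigma> | b1 b2 \<sigma>. b1 permutes UNIV \<and> b2 permutes UNIV \<and> \<sigma> permutes {L1, L2}}"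

definition mother_group :: "(word \<Rightarrow> word) monoid" where
  "mother_group = subgroup_generated tree_aut mother_generators"


section \<open>The subgroup \<open>T\<close>\<close>

definition swap23 :: "letter \<Rightarrow> letter" where
  "swap23 = Transposition.transpose L2 L3"

definition c_elem :: "word \<Rightarrow> word" where
  "c_elem = directed id swap23 id"

definition t_root :: "word \<Rightarrow> word" where
  "t_root = rooted swap23 \<otimes>\<^bsub>tree_aut\<^esub> c_elem \<otimes>\<^bsub>tree_aut\<^esub> rooted swap23 \<otimes>\<^bsub>tree_aut\<^esub> c_elem"

primrec t_elem :: "word \<Rightarrow> word \<Rightarrow> word" where
  "t_elem [] = t_root"
| "t_elem (x # v) = wreath ((\<lambda>_. id)(x := t_elem v)) id"

definition T_group :: "(word \<Rightarrow> word) monoid" where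
  "T_group = subgroup_generated mother_group (range t_elem)"

lemma c_elem_wreath: "c_elem = wreath (triple id (rooted swap23) c_elem) id"
proof -
  have "rooted id = id"
  proof
    fix w show "rooted id w = id w" by (cases w) (auto simp: rooted_def)
  qed
  then show ?thesis unfolding c_elem_def by (subst directed_wreath) simp
qed

lemma t_root_wreath:
  "t_root = wreath (triple id (c_elem \<otimes>\<^bsub>tree_aut\<^esub> rooted swap23)
                              (rooted swap23 \<otimes>\<^bsub>tree_aut\<^esub> c_elem)) id"
proof
  have c: "c_elem (x # u) = x # triple id (rooted swap23) c_elem x u" for x u
    by (subst c_elem_wreath) simp
  have r: "rooted swap23 (x # u) = swap23 x # u" for x u by (simp add: rooted_def)
  have e: "c_elem [] = []" "rooted swap23 [] = []" by (simp_all add: c_elem_def rooted_def)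
  have s: "swap23 L1 = L1" "swap23 L2 = L3" "swap23 L3 = L2"
    by (auto simp: swap23_def transpose_def)
  fix w show "t_root w = wreath (triple id (c_elem \<otimes>\<^bsub>tree_aut\<^esub> rooted swap23)
                              (rooted swap23 \<otimes>\<^bsub>tree_aut\<^esub> c_elem)) id w"
  proof (cases w)
    case (Cons x u) then show ?thesis
      by (cases x) (simp_all add: t_root_def tree_aut_def c r s)
  qed (simp add: t_root_def tree_aut_def e)
qed

text \<open>\<open>subgroup_generated\<close> intersects the generating set with the carrier, so it matters that
  the generators are tree automorphisms, and that all \<open>t\<^sub>v\<close> lie in the mother group.\<close>

lemma tree_adjacent_simps [simp]:
  "tree_adjacent (x # u) (y # v) \<longleftrightarrow> x = y \<and> tree_adjacent u v"
  "tree_adjacent [] v \<longleftrightarrow> length v = 1"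
  "tree_adjacent u [] \<longleftrightarrow> length u = 1"
  by (auto simp: tree_adjacent_def length_Suc_conv Cons_eq_append_conv)

lemma tree_aut_group: "group tree_aut"
proof (rule groupI)
  fix g assume g: "g \<in> carrier tree_aut"
  have b: "bij g" using g by (simp add: tree_aut_def)
  have [simp]: "g (inv_into UNIV g w) = w" for w using b by (meson bij_inv_eq_iff)
  have "inv_into UNIV g \<in> carrier tree_aut"
    using g b by (auto simp: tree_aut_def bij_imp_bij_inv)
      (metis \<open>\<And>w. g (inv_into UNIV g w) = w\<close> bij_inv_eq_iff)+
  moreover have "inv_into UNIV g \<otimes>\<^bsub>tree_aut\<^esub> g = \<one>\<^bsub>tree_aut\<^esub>"
    by (auto simp: tree_aut_def)
  ultimately show "\<exists>h\<in>carrier tree_aut. h \<otimes>\<^bsub>tree_aut\<^esub> g = \<one>\<^bsub>tree_aut\<^esub>" by blast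
qed (auto simp: tree_aut_def intro: bij_comp)

lemma wreath_in_tree_aut:
  assumes f: "\<And>x. f x \<in> carrier tree_aut" and \<sigma>: "bij \<sigma>"
  shows "wreath f \<sigma> \<in> carrier tree_aut"
proof -
  have b: "bij (f x)" and n: "f x [] = []"
    and a: "tree_adjacent (f x u) (f x v) \<longleftrightarrow> tree_adjacent u v" for x u v
    using f[of x] by (auto simp: tree_aut_def)
  have n': "f x w = [] \<longleftrightarrow> w = []" for x w
    using b[of x] n[of x] by (metis bij_pointE)
  have i: "inj (wreath f \<sigma>)"
  proof (rule injI)
    fix u v assume "wreath f \<sigma> u = wreath f \<sigma> v"
    then show "u = v"
      using b \<sigma> by (cases u; cases v) (auto dest!: bij_is_inj dest: injD)
  qed
  have s: "\<exists>u. wreath f \<sigma> u = v" for v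
  proof (cases v)
    case Nil then show ?thesis by (intro exI[of _ "[]"]) simp
  next
    case (Cons y w)
    obtain x where x: "\<sigma> x = y" using \<sigma> by (metis bij_pointE)
    obtain u where "f x u = w" using b[of x] by (metis bij_pointE)
    then show ?thesis using x Cons by (intro exI[of _ "x # u"]) simp
  qed
  have "tree_adjacent (wreath f \<sigma> u) (wreath f \<sigma> v) \<longleftrightarrow> tree_adjacent u v" for u v
    using a n' \<sigma> by (cases u; cases v) (auto dest!: bij_is_inj dest: injD)
  then show ?thesis using i s
    by (auto simp: tree_aut_def bij_def surj_def) metis
qed

lemma rooted_in_tree_aut: "bij a \<Longrightarrow> rooted a \<in> carrier tree_aut"
  unfolding rooted_def by (rule wreath_in_tree_aut) (auto simp: tree_aut_def)

lemma directed_in_tree_aut: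
  assumes "bij b1" "bij b2" "bij \<sigma>"
  shows "directed b1 b2 \<sigma> \<in> carrier tree_aut"
proof -
  let ?d = "directed b1 b2 \<sigma>"
  have r: "bij (rooted a)" "rooted a [] = []"
      "tree_adjacent (rooted a u) (rooted a v) \<longleftrightarrow> tree_adjacent u v" if "bij a" for a u v
    using rooted_in_tree_aut[OF that] by (auto simp: tree_aut_def)
  have n: "rooted a w = [] \<longleftrightarrow> w = []" "?d w = [] \<longleftrightarrow> w = []" for a w
    by (cases w; simp add: rooted_def)+
  have ri: "rooted a u = rooted a v \<longleftrightarrow> u = v" if "bij a" for a u v
    using r(1)[OF that] by (auto dest: bij_is_inj injD)
  have si: "\<sigma> x = \<sigma> y \<longleftrightarrow> x = y" for x y using assms(3) by (auto dest: bij_is_inj injD)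
  have i: "?d u = ?d v \<Longrightarrow> u = v" for u v
  proof (induction u arbitrary: v)
    case Nil then show ?case by (cases v) auto
  next
    case (Cons x u)
    then show ?case
      by (cases v; cases x) (auto simp: ri assms si)
  qed
  have s: "\<exists>u. ?d u = v" for v
  proof (induction v)
    case Nil then show ?case by (intro exI[of _ "[]"]) simp
  next
    case (Cons y v)
    obtain x where x: "\<sigma> x = y" using assms(3) by (metis bij_pointE)
    have "\<exists>u. triple (rooted b1 u) (rooted b2 u) (?d u) x = v"
      using Cons r(1)[OF assms(1)] r(1)[OF assms(2)] by (cases x) (simp; metis bij_pointE)+
    then obtain u where "triple (rooted b1 u) (rooted b2 u) (?d u) x = v" by blast
    then show ?case using x by (intro exI[of _ "x # u"]) simp
  qed
  have a: "tree_adjacent (?d u) (?d v) \<longleftrightarrow> tree_adjacent u v" for u v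
  proof (induction u arbitrary: v)
    case Nil
    show ?case
    proof (cases v)
      case (Cons x w) then show ?thesis by (cases x) (auto simp: n)
    qed simp
  next
    case (Cons x u)
    show ?case
    proof (cases v)
      case Nil then show ?thesis by (cases x) (auto simp: n)
    next
      case (Cons y w)
      then show ?thesis using Cons.IH
        by (cases "x = y"; cases x) (auto simp: si r(3) assms)
    qed
  qed
  show ?thesis using i s a
    by (auto simp: tree_aut_def bij_def surj_def inj_def) metis
qed

lemma mother_generators_in_tree_aut: "mother_generators \<subseteq> carrier tree_aut"
  unfolding mother_generators_def
  by (auto intro!: rooted_in_tree_aut directed_in_tree_aut dest: permutes_bij)

lemma mother_group_group: "group mother_group"
  unfolding mother_group_def by (rule group.group_subgroup_generated[OF tree_aut_group])


lemma mother_group_subgroup: "subgroup (carrier mother_group) tree_aut"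
  unfolding mother_group_def by (rule group.subgroup_subgroup_generated[OF tree_aut_group])

lemma mother_group_carrier: "carrier mother_group = generate tree_aut mother_generators"
  using mother_generators_in_tree_aut
  by (simp add: mother_group_def carrier_subgroup_generated Int_absorb1)

lemma tree_aut_simps: "\<one>\<^bsub>tree_aut\<^esub> = id" "g \<otimes>\<^bsub>tree_aut\<^esub> h = h \<circ> g"
  by (simp_all add: tree_aut_def)

lemma wreath_id: "wreath (\<lambda>_. id) id = id"
proof
  fix w show "wreath (\<lambda>_. id) id w = id w" by (cases w) auto
qed

lemma wreath_inv:
  assumes "\<And>x. f x \<in> carrier tree_aut"
  shows "inv\<^bsub>tree_aut\<^esub> (wreath f id) = wreath (\<lambda>x. inv\<^bsub>tree_aut\<^esub> (f x)) id"
proof -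
  interpret group tree_aut by (rule tree_aut_group)
  show ?thesis
  proof (rule inv_equality)
    show "wreath (\<lambda>x. inv\<^bsub>tree_aut\<^esub> (f x)) id \<otimes>\<^bsub>tree_aut\<^esub> wreath f id = \<one>\<^bsub>tree_aut\<^esub>"
      unfolding wreath_mult using assms by (simp add: tree_aut_simps(1) wreath_id)
  qed (auto intro!: wreath_in_tree_aut assms)
qed

lemma mother_rooted: "a permutes UNIV \<Longrightarrow> rooted a \<in> carrier mother_group"
  unfolding mother_group_carrier by (rule generate.incl) (auto simp: mother_generators_def)

lemma mother_directed:
  "b1 permutes UNIV \<Longrightarrow> b2 permutes UNIV \<Longrightarrow> \<sigma> permutes {L1, L2}
    \<Longrightarrow> directed b1 b2 \<sigma> \<in> carrier mother_group"
  unfolding mother_group_carrier by (rule generate.incl) (auto simp: mother_generators_def)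

lemma transpose_permutes_UNIV: "Transposition.transpose x y permutes UNIV"
  by (rule permutes_swap_id) auto

lemma mother_wreath_transpose:
  assumes "wreath f id \<in> carrier mother_group"
  shows "wreath (\<lambda>z. f (Transposition.transpose x y z)) id \<in> carrier mother_group"
proof -
  interpret subgroup "carrier mother_group" tree_aut by (rule mother_group_subgroup)
  let ?t = "Transposition.transpose x y"
  have "rooted ?t \<otimes>\<^bsub>tree_aut\<^esub> wreath f id \<otimes>\<^bsub>tree_aut\<^esub> rooted ?t \<in> carrier mother_group"
    by (intro m_closed assms mother_rooted transpose_permutes_UNIV)
  also have "rooted ?t \<otimes>\<^bsub>tree_aut\<^esub> wreath f id \<otimes>\<^bsub>tree_aut\<^esub> rooted ?t = wreath (\<lambda>z. f (?t z)) id"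
    unfolding rooted_def wreath_mult
    by (rule arg_cong2[where f = wreath]) (auto simp: fun_eq_iff tree_aut_simps)
  finally show ?thesis .
qed

lemma mother_third_section:
  assumes "g \<in> carrier mother_group"
  shows "\<exists>k\<in>carrier tree_aut. wreath (triple id k g) id \<in> carrier mother_group"
proof -
  interpret group tree_aut by (rule tree_aut_group)
  interpret M: subgroup "carrier mother_group" tree_aut by (rule mother_group_subgroup)
  have id: "id \<in> carrier tree_aut" using one_closed by (simp add: tree_aut_simps)
  have L1: "wreath (triple (rooted a) (directed a id id) id) id \<in> carrier mother_group"
    and L2: "wreath (triple id (directed a id id) (rooted a)) id \<in> carrier mother_group"
    and L3: "directed a id id \<in> carrier tree_aut"
    if a: "a permutes UNIV" for a
  proof -
    have r: "rooted id = id" by (simp add: rooted_def wreath_id)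
    have d: "directed a id id \<in> carrier mother_group"
      by (rule mother_directed) (auto simp: a)
    show "directed a id id \<in> carrier tree_aut" using d M.subset by blast
    have w: "wreath (triple (rooted a) id (directed a id id)) id \<in> carrier mother_group"
      using d by (subst (asm) directed_wreath) (simp add: r)
    have e1: "(\<lambda>z. triple (rooted a) id (directed a id id) (Transposition.transpose L2 L3 z))
       = triple (rooted a) (directed a id id) id"
    proof
      fix z show "triple (rooted a) id (directed a id id) (Transposition.transpose L2 L3 z)
       = triple (rooted a) (directed a id id) id z"
        by (cases z) (auto simp: transpose_def)
    qed
    show 1: "wreath (triple (rooted a) (directed a id id) id) id \<in> carrier mother_group"
      using mother_wreath_transpose[OF w, of L2 L3] by (simp add: e1)
    have e2: "(\<lambda>z. triple (rooted a) (directed a id id) id (Transposition.transpose L1 L3 z))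
       = triple id (directed a id id) (rooted a)"
    proof
      fix z show "triple (rooted a) (directed a id id) id (Transposition.transpose L1 L3 z)
       = triple id (directed a id id) (rooted a) z"
        by (cases z) (auto simp: transpose_def)
    qed
    show "wreath (triple id (directed a id id) (rooted a)) id \<in> carrier mother_group"
      using mother_wreath_transpose[OF 1, of L1 L3] by (simp add: e2)
  qed
  have gen: "\<exists>k\<in>carrier tree_aut. wreath (triple id k h) id \<in> carrier mother_group"
    if hg: "h \<in> mother_generators" for h
  proof -
    consider a where "a permutes UNIV" "h = rooted a"
      | b1 b2 \<sigma> where "b1 permutes UNIV" "b2 permutes UNIV" "\<sigma> permutes {L1, L2}"
          "h = directed b1 b2 \<sigma>"
      using hg by (auto simp: mother_generators_def)
    then show ?thesis
    proof cases
      case 1 then show ?thesis using L2 L3 by blast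
    next
      case 2
      let ?i = "inv_into UNIV b1" and ?s = "inv_into UNIV \<sigma>"
      have i: "?i permutes UNIV" using 2 by (simp add: permutes_inv)
      have "?s permutes {L1, L2}" using 2 by (simp add: permutes_inv)
      then have s: "?s permutes UNIV" by (rule permutes_subset) simp
      have h: "h \<in> carrier mother_group" using 2 mother_directed by blast
      let ?d = "directed ?i id id"
      let ?k = "rooted b2 \<otimes>\<^bsub>tree_aut\<^esub> ?d"
      have "h \<otimes>\<^bsub>tree_aut\<^esub> rooted ?s \<otimes>\<^bsub>tree_aut\<^esub> wreath (triple (rooted ?i) ?d id) id
          \<in> carrier mother_group"
        by (intro M.m_closed h mother_rooted s L1 i)
      also have "h \<otimes>\<^bsub>tree_aut\<^esub> rooted ?s = wreath (triple (rooted b1) (rooted b2) h) id"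
      proof -
        have "?s \<circ> \<sigma> = id" using 2 by (simp add: permutes_inv_o)
        moreover have "h = wreath (triple (rooted b1) (rooted b2) h) \<sigma>"
          using 2 directed_wreath by metis
        then have "h \<otimes>\<^bsub>tree_aut\<^esub> rooted ?s
            = wreath (triple (rooted b1) (rooted b2) h) \<sigma> \<otimes>\<^bsub>tree_aut\<^esub> wreath (\<lambda>_. id) ?s"
          by (simp add: rooted_def)
        ultimately show ?thesis unfolding wreath_mult by (simp add: tree_aut_simps)
      qed
      also have "wreath (triple (rooted b1) (rooted b2) h) id
            \<otimes>\<^bsub>tree_aut\<^esub> wreath (triple (rooted ?i) ?d id) id = wreath (triple id ?k h) id"
      proof -
        have "rooted b1 \<otimes>\<^bsub>tree_aut\<^esub> rooted ?i = id"
          using 2 unfolding rooted_def wreath_mult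
          by (simp add: tree_aut_simps permutes_inv_o wreath_id)
        then have "triple (rooted b1) (rooted b2) h x \<otimes>\<^bsub>tree_aut\<^esub> triple (rooted ?i) ?d id x
             = triple id ?k h x" for x
          by (cases x) (auto simp: tree_aut_simps)
        then show ?thesis unfolding wreath_mult by simp
      qed
      finally have "wreath (triple id ?k h) id \<in> carrier mother_group" .
      moreover have "?k \<in> carrier tree_aut"
        using 2 by (intro m_closed L3 i rooted_in_tree_aut) (auto dest: permutes_bij)
      ultimately show ?thesis by blast
    qed
  qed
  from assms have "g \<in> generate tree_aut mother_generators" by (simp add: mother_group_carrier)
  then show ?thesis
  proof (induction)
    case one
    have "triple id id id = (\<lambda>_. id :: word \<Rightarrow> word)"
    proof
      fix x show "triple id id id x = (id :: word \<Rightarrow> word)" by (cases x) auto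
    qed
    then have "wreath (triple id id id) id \<in> carrier mother_group"
      using M.one_closed by (simp add: tree_aut_simps wreath_id)
    then show ?case unfolding tree_aut_simps by (intro bexI[OF _ id])
  next
    case (incl h) then show ?case by (rule gen)
  next
    case (inv h)
    then have h: "h \<in> carrier tree_aut" using mother_generators_in_tree_aut by blast
    obtain k where k: "k \<in> carrier tree_aut" "wreath (triple id k h) id \<in> carrier mother_group"
      using gen inv by blast
    have "triple id k h x \<in> carrier tree_aut" for x using id k h by (cases x) auto
    then have "inv\<^bsub>tree_aut\<^esub> (wreath (triple id k h) id)
        = wreath (\<lambda>x. inv\<^bsub>tree_aut\<^esub> (triple id k h x)) id"
      by (rule wreath_inv)
    also have "(\<lambda>x. inv\<^bsub>tree_aut\<^esub> (triple id k h x))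
        = triple id (inv\<^bsub>tree_aut\<^esub> k) (inv\<^bsub>tree_aut\<^esub> h)"
    proof
      fix x
      have "inv\<^bsub>tree_aut\<^esub> id = id" using inv_one by (simp add: tree_aut_simps)
      then show "inv\<^bsub>tree_aut\<^esub> (triple id k h x)
        = triple id (inv\<^bsub>tree_aut\<^esub> k) (inv\<^bsub>tree_aut\<^esub> h) x"
        by (cases x) auto
    qed
    finally show ?case
      using M.m_inv_closed[OF k(2)] by (intro bexI[OF _ inv_closed[OF k(1)]]) (simp only:)
  next
    case (eng g h)
    then obtain k l where k: "k \<in> carrier tree_aut" "wreath (triple id k g) id \<in> carrier mother_group"
      and l: "l \<in> carrier tree_aut" "wreath (triple id l h) id \<in> carrier mother_group"
      by blast
    have "triple id k g x \<otimes>\<^bsub>tree_aut\<^esub> triple id l h x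
       = triple id (k \<otimes>\<^bsub>tree_aut\<^esub> l) (g \<otimes>\<^bsub>tree_aut\<^esub> h) x" for x
      by (cases x) (auto simp: tree_aut_simps)
    then have "wreath (triple id (k \<otimes>\<^bsub>tree_aut\<^esub> l) (g \<otimes>\<^bsub>tree_aut\<^esub> h)) id \<in> carrier mother_group"
      using M.m_closed[OF k(2) l(2)] unfolding wreath_mult by simp
    then show ?case using k l by blast
  qed
qed

text \<open>If \<open>w\<close> is a commutator of elements of the mother group, so is the automorphism with \<open>w\<close> at
  one letter and the identity at the others; hence every \<open>t\<^sub>v\<close> is such a commutator.\<close>

definition mother_commutators :: "(word \<Rightarrow> word) set" where
  "mother_commutators = {g \<otimes>\<^bsub>tree_aut\<^esub> h \<otimes>\<^bsub>tree_aut\<^esub> inv\<^bsub>tree_aut\<^esub> g \<otimes>\<^bsub>tree_aut\<^esub> inv\<^bsub>tree_aut\<^esub> h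
     | g h. g \<in> carrier mother_group \<and> h \<in> carrier mother_group}"

lemma mother_commutators_section:
  assumes "w \<in> mother_commutators"
  shows "wreath ((\<lambda>_. id)(x := w)) id \<in> mother_commutators"
proof -
  interpret group tree_aut by (rule tree_aut_group)
  interpret M: subgroup "carrier mother_group" tree_aut by (rule mother_group_subgroup)
  have id: "id \<in> carrier tree_aut" using one_closed by (simp add: tree_aut_simps)
  have iid: "inv\<^bsub>tree_aut\<^esub> id = id" using inv_one by (simp add: tree_aut_simps)
  obtain g h where gh: "g \<in> carrier mother_group" "h \<in> carrier mother_group"
    and w: "w = g \<otimes>\<^bsub>tree_aut\<^esub> h \<otimes>\<^bsub>tree_aut\<^esub> inv\<^bsub>tree_aut\<^esub> g \<otimes>\<^bsub>tree_aut\<^esub> inv\<^bsub>tree_aut\<^esub> h"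
    using assms by (auto simp: mother_commutators_def)
  have gh': "g \<in> carrier tree_aut" "h \<in> carrier tree_aut" using gh M.subset by auto
  obtain k l where k: "k \<in> carrier tree_aut" "wreath (triple id k g) id \<in> carrier mother_group"
    and l: "l \<in> carrier tree_aut" "wreath (triple id l h) id \<in> carrier mother_group"
    using mother_third_section gh by blast
  define A where "A = triple id k g"
  define B where "B = (\<lambda>z. triple id l h (Transposition.transpose L1 L2 z))"
  define t where "t = Transposition.transpose x L3"
  have A: "wreath (\<lambda>z. A (t z)) id \<in> carrier mother_group"
    unfolding t_def by (rule mother_wreath_transpose) (simp add: A_def k)
  have B: "wreath (\<lambda>z. B (t z)) id \<in> carrier mother_group"
    unfolding t_def
    by (rule mother_wreath_transpose) (simp add: B_def mother_wreath_transpose[OF l(2)])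
  have Ac: "A z \<in> carrier tree_aut" for z using id k gh' by (cases z) (auto simp: A_def)
  have Bc: "B z \<in> carrier tree_aut" for z
    using id l gh' by (cases z) (auto simp: B_def transpose_def)
  have "A z \<otimes>\<^bsub>tree_aut\<^esub> B z \<otimes>\<^bsub>tree_aut\<^esub> inv\<^bsub>tree_aut\<^esub> (A z) \<otimes>\<^bsub>tree_aut\<^esub> inv\<^bsub>tree_aut\<^esub> (B z)
      = (if z = L3 then w else id)" for z
  proof (cases z)
    case L1
    have "l \<otimes>\<^bsub>tree_aut\<^esub> inv\<^bsub>tree_aut\<^esub> l = id" using l r_inv by (simp add: tree_aut_simps(1))
    then show ?thesis using L1 by (simp add: A_def B_def iid tree_aut_simps)
  next
    case L2
    have "k \<otimes>\<^bsub>tree_aut\<^esub> inv\<^bsub>tree_aut\<^esub> k = id" using k r_inv by (simp add: tree_aut_simps(1))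
    then show ?thesis using L2 by (simp add: A_def B_def iid tree_aut_simps)
  next
    case L3
    then show ?thesis by (simp add: A_def B_def w)
  qed
  moreover have "t z = L3 \<longleftrightarrow> z = x" for z
    unfolding t_def by (metis transpose_apply_second transpose_involutory)
  ultimately have "(\<lambda>_. id)(x := w) = (\<lambda>z. A (t z) \<otimes>\<^bsub>tree_aut\<^esub> B (t z)
      \<otimes>\<^bsub>tree_aut\<^esub> inv\<^bsub>tree_aut\<^esub> (A (t z)) \<otimes>\<^bsub>tree_aut\<^esub> inv\<^bsub>tree_aut\<^esub> (B (t z)))"
    by (auto simp: fun_eq_iff)
  then have "wreath ((\<lambda>_. id)(x := w)) id
      = wreath (\<lambda>z. A (t z)) id \<otimes>\<^bsub>tree_aut\<^esub> wreath (\<lambda>z. B (t z)) id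
        \<otimes>\<^bsub>tree_aut\<^esub> inv\<^bsub>tree_aut\<^esub> (wreath (\<lambda>z. A (t z)) id)
        \<otimes>\<^bsub>tree_aut\<^esub> inv\<^bsub>tree_aut\<^esub> (wreath (\<lambda>z. B (t z)) id)"
    by (simp add: wreath_inv Ac Bc wreath_mult)
  then show ?thesis unfolding mother_commutators_def using A B by blast
qed

lemma t_root_commutator: "t_root \<in> mother_commutators"
proof -
  interpret group tree_aut by (rule tree_aut_group)
  interpret M: subgroup "carrier mother_group" tree_aut by (rule mother_group_subgroup)
  have s: "swap23 permutes UNIV" unfolding swap23_def by (rule transpose_permutes_UNIV)
  have r: "rooted swap23 \<in> carrier mother_group" using s by (rule mother_rooted)
  have c: "c_elem \<in> carrier mother_group"
    unfolding c_elem_def by (rule mother_directed) (auto simp: s)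
  have rr: "rooted swap23 (rooted swap23 w) = w" for w
    by (cases w) (auto simp: rooted_def swap23_def)
  have ri: "rooted id w = w" for w by (simp add: rooted_def wreath_id)
  have cc: "c_elem (c_elem w) = w" for w
    unfolding c_elem_def
  proof (induction w)
    case (Cons x w) then show ?case by (cases x) (auto simp: rr ri ri[unfolded id_def])
  qed simp
  have "inv\<^bsub>tree_aut\<^esub> (rooted swap23) = rooted swap23"
    using r M.subset by (intro inv_equality) (auto simp: tree_aut_simps rr)
  moreover have "inv\<^bsub>tree_aut\<^esub> c_elem = c_elem"
    using c M.subset by (intro inv_equality) (auto simp: tree_aut_simps cc)
  ultimately show ?thesis
    unfolding mother_commutators_def t_root_def using r c by auto metis
qed

lemma t_elem_in_mother_group: "t_elem v \<in> carrier mother_group"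
proof -
  interpret group tree_aut by (rule tree_aut_group)
  interpret M: subgroup "carrier mother_group" tree_aut by (rule mother_group_subgroup)
  have "t_elem v \<in> mother_commutators"
    by (induction v) (auto simp: t_root_commutator intro!: mother_commutators_section)
  then show ?thesis by (auto simp: mother_commutators_def)
qed

lemma T_group_carrier: "carrier T_group = generate tree_aut (range t_elem)"
proof -
  interpret group tree_aut by (rule tree_aut_group)
  have r: "range t_elem \<subseteq> carrier mother_group" using t_elem_in_mother_group by auto
  have "carrier T_group = generate mother_group (range t_elem)"
    using r by (simp add: T_group_def carrier_subgroup_generated Int_absorb1)
  also have "mother_group = tree_aut\<lparr>carrier := carrier mother_group\<rparr>"
    by (simp add: mother_group_def subgroup_generated_def)
  finally show ?thesis
    using generate_consistent[OF r mother_group_subgroup] by simp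
qed

lemma T_group_group: "group T_group"
  unfolding T_group_def by (rule group.group_subgroup_generated[OF mother_group_group])


section \<open>Proper length functions and the metrics they induce\<close>

definition length_function :: "('g, 'm) monoid_scheme \<Rightarrow> ('g \<Rightarrow> real) \<Rightarrow> bool" where
  "length_function G l \<longleftrightarrow>
     (\<forall>g\<in>carrier G. 0 \<le> l g \<and> (l g = 0 \<longleftrightarrow> g = \<one>\<^bsub>G\<^esub>) \<and> l (inv\<^bsub>G\<^esub> g) = l g) \<and>
     (\<forall>g\<in>carrier G. \<forall>h\<in>carrier G. l (g \<otimes>\<^bsub>G\<^esub> h) \<le> l g + l h)"

definition proper_length :: "('g, 'm) monoid_scheme \<Rightarrow> ('g \<Rightarrow> real) \<Rightarrow> bool" where
  "proper_length G l \<longleftrightarrow> length_function G l \<and> (\<forall>R. finite {g \<in> carrier G. l g \<le> R})"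

text \<open>The type of metrics demands nonnegativity and symmetry of the distance function
  off the carrier too, whence the value 0 there.\<close>

definition length_metric :: "('g, 'm) monoid_scheme \<Rightarrow> ('g \<Rightarrow> real) \<Rightarrow> 'g metric" where
  "length_metric G l = metric (carrier G,
     \<lambda>g h. if g \<in> carrier G \<and> h \<in> carrier G then l (g \<otimes>\<^bsub>G\<^esub> inv\<^bsub>G\<^esub> h) else 0)"

lemma length_metric:
  assumes "group G" "length_function G l"
  shows mspace_length_metric: "mspace (length_metric G l) = carrier G"
    and mdist_length_metric: "g \<in> carrier G \<Longrightarrow> h \<in> carrier G
           \<Longrightarrow> mdist (length_metric G l) g h = l (g \<otimes>\<^bsub>G\<^esub> inv\<^bsub>G\<^esub> h)"
proof -
  interpret group G by fact
  let ?d = "\<lambda>g h. if g \<in> carrier G \<and> h \<in> carrier G then l (g \<otimes>\<^bsub>G\<^esub> inv\<^bsub>G\<^esub> h) else 0"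
  have l: "0 \<le> l g" "l g = 0 \<longleftrightarrow> g = \<one>\<^bsub>G\<^esub>" "l (inv\<^bsub>G\<^esub> g) = l g" if "g \<in> carrier G" for g
    using assms(2) that by (auto simp: length_function_def)
  have tri: "l (g \<otimes>\<^bsub>G\<^esub> h) \<le> l g + l h" if "g \<in> carrier G" "h \<in> carrier G" for g h
    using assms(2) that by (auto simp: length_function_def)
  have "Metric_space (carrier G) ?d"
  proof
    fix x y show "0 \<le> ?d x y" using l(1) by auto
    show "?d x y = ?d y x"
    proof (cases "x \<in> carrier G \<and> y \<in> carrier G")
      case True
      then have "inv\<^bsub>G\<^esub> (x \<otimes>\<^bsub>G\<^esub> inv\<^bsub>G\<^esub> y) = y \<otimes>\<^bsub>G\<^esub> inv\<^bsub>G\<^esub> x"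
        by (simp add: inv_mult_group)
      then show ?thesis using l(3)[of "x \<otimes>\<^bsub>G\<^esub> inv\<^bsub>G\<^esub> y"] True by simp
    qed auto
  next
    fix x y assume "x \<in> carrier G" "y \<in> carrier G"
    then show "?d x y = 0 \<longleftrightarrow> x = y"
      using l(2)[of "x \<otimes>\<^bsub>G\<^esub> inv\<^bsub>G\<^esub> y"] by simp (metis inv_equality inv_inv inv_closed r_inv)
  next
    fix x y z assume xyz: "x \<in> carrier G" "y \<in> carrier G" "z \<in> carrier G"
    have "x \<otimes>\<^bsub>G\<^esub> inv\<^bsub>G\<^esub> z = (x \<otimes>\<^bsub>G\<^esub> inv\<^bsub>G\<^esub> y) \<otimes>\<^bsub>G\<^esub> (y \<otimes>\<^bsub>G\<^esub> inv\<^bsub>G\<^esub> z)"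
      using xyz by (simp add: m_assoc) (metis inv_closed l_one l_inv m_assoc)
    then show "?d x z \<le> ?d x y + ?d y z"
      using xyz tri[of "x \<otimes>\<^bsub>G\<^esub> inv\<^bsub>G\<^esub> y" "y \<otimes>\<^bsub>G\<^esub> inv\<^bsub>G\<^esub> z"] by simp
  qed
  then show "mspace (length_metric G l) = carrier G"
    "g \<in> carrier G \<Longrightarrow> h \<in> carrier G \<Longrightarrow> mdist (length_metric G l) g h = l (g \<otimes>\<^bsub>G\<^esub> inv\<^bsub>G\<^esub> h)"
    by (simp_all add: length_metric_def Metric_space.mspace_metric Metric_space.mdist_metric)
qed


section \<open>Decomposition complexity\<close>

text \<open>A metric family is a set of metric spaces. The infimum is taken in the extended reals,
  so that it is \<open>\<infinity>\<close> when one of the two sets is empty.\<close>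

definition r_disjoint :: "'a metric \<Rightarrow> real \<Rightarrow> 'a set set \<Rightarrow> bool" where
  "r_disjoint m r \<U> \<longleftrightarrow> (\<forall>U\<in>\<U>. \<forall>V\<in>\<U>. U \<noteq> V \<longrightarrow>
     (INF (x, y)\<in>U \<times> V. ereal (mdist m x y)) > ereal r)"

definition r_decomposable :: "real \<Rightarrow> 'a metric set \<Rightarrow> 'a metric set \<Rightarrow> bool" where
  "r_decomposable r F G \<longleftrightarrow> (\<forall>Z\<in>F. \<exists>\<U>\<^sub>0 \<U>\<^sub>1.
     mspace Z = \<Union>\<U>\<^sub>0 \<union> \<Union>\<U>\<^sub>1 \<and> r_disjoint Z r \<U>\<^sub>0 \<and> r_disjoint Z r \<U>\<^sub>1 \<and>
     (\<forall>U \<in> \<U>\<^sub>0 \<union> \<U>\<^sub>1. submetric Z U \<in> G))"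

definition bounded_family :: "'a metric set \<Rightarrow> bool" where
  "bounded_family F \<longleftrightarrow> (\<exists>B. \<forall>Z\<in>F. \<forall>x\<in>mspace Z. \<forall>y\<in>mspace Z. mdist Z x y \<le> B)"

text \<open>\<open>decomposition_class R F\<close> says that \<open>F \<in> \<D>\<^sub>\<alpha>\<close> where the ordinal \<open>\<alpha>\<close> is the order type of
  the well-order \<open>R\<close> (a reflexive relation, as usual in HOL). The ordinal 0 is the empty
  relation, the ordinals \<open>\<beta> < \<alpha>\<close> are the order types of the proper initial segments
  \<open>{b. b < a}\<close> of \<open>R\<close>, and \<open>\<omega>\<close> is \<open>natLeq\<close>. Since the recursion is well-founded, the inductive
  definition has a unique fixed point for every well-order \<open>R\<close>.\<close>

inductive decomposition_class :: "'o rel \<Rightarrow> 'a metric set \<Rightarrow> bool" where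
  zero: "bounded_family F \<Longrightarrow> decomposition_class {} F"
| pos: "R \<noteq> {} \<Longrightarrow>
    (\<And>r. r > 0 \<Longrightarrow> \<exists>a\<in>Field R. \<exists>G.
       decomposition_class (Restr R (underS R a)) G \<and> r_decomposable r F G) \<Longrightarrow>
    decomposition_class R F"

lemma decomposition_class_iff:
  "decomposition_class R F \<longleftrightarrow>
     (if R = {} then bounded_family F
      else \<forall>r>0. \<exists>a\<in>Field R. \<exists>G. decomposition_class (Restr R (underS R a)) G \<and>
             r_decomposable r F G)"
  by (subst decomposition_class.simps) auto

lemma decomposition_class_omega:
  "decomposition_class natLeq F \<longleftrightarrow>
     (\<forall>r>0. \<exists>n. \<exists>G. decomposition_class (natLeq_on n) G \<and> r_decomposable r F G)"
proof -
  have "natLeq \<noteq> {}" by (auto simp: natLeq_def)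
  then show ?thesis
    by (subst decomposition_class_iff) (simp add: Field_natLeq Restr_natLeq2)
qed

text \<open>The ordinals in the following definition are the order types of the well-orders of sets of
  sets of naturals. By \<open>finite_decomposition_complexityI\<close> below, no larger ordinals are needed:
  only integral \<open>r\<close> matter, so the classes \<open>\<D>\<^sub>\<alpha>\<close> stabilise at the first uncountable ordinal.\<close>

definition finite_decomposition_complexity :: "'a metric \<Rightarrow> bool" where
  "finite_decomposition_complexity Y \<longleftrightarrow>
     (\<exists>R :: nat set rel. Well_order R \<and> decomposition_class R {Y})"

lemma r_decomposable_mono: "r_decomposable s F G \<Longrightarrow> r \<le> s \<Longrightarrow> r_decomposable r F G"
  unfolding r_decomposable_def r_disjoint_def by (meson ereal_less_eq(3) order_le_less_trans)


lemma bounded_decomposition_class: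
  assumes "Well_order R" "bounded_family F" shows "decomposition_class R F"
proof (cases "R = {}")
  case False
  interpret wo_rel R using assms(1) by unfold_locales
  have "Field R \<noteq> {}" using False by (auto simp: Field_def)
  then obtain a where a: "a \<in> Field R" "\<forall>b\<in>Field R. (a, b) \<in> R"
    using Well_order_isMinim_exists[of "Field R"] by (auto simp: isMinim_def)
  have "underS a = {}"
    using a ANTISYM by (auto simp: underS_def antisym_def Field_def)
  then have "decomposition_class (Restr R (underS a)) F" using assms zero by simp
  moreover have "r_decomposable r F F" for r
    unfolding r_decomposable_def
  proof
    fix Z assume Z: "Z \<in> F"
    show "\<exists>\<U>\<^sub>0 \<U>\<^sub>1. mspace Z = \<Union>\<U>\<^sub>0 \<union> \<Union>\<U>\<^sub>1 \<and> r_disjoint Z r \<U>\<^sub>0 \<and> r_disjoint Z r \<U>\<^sub>1 \<and>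
     (\<forall>U \<in> \<U>\<^sub>0 \<union> \<U>\<^sub>1. submetric Z U \<in> F)"
      by (intro exI[of _ "{mspace Z}"]) (auto simp: r_disjoint_def Z)
  qed
  ultimately show ?thesis using False a by (intro pos) blast+
qed (use assms zero in auto)

lemma Restr_underS_underS:
  assumes "Well_order R" "a \<in> underS R b"
  shows "Restr (Restr R (underS R b)) (underS (Restr R (underS R b)) a) = Restr R (underS R a)"
proof -
  interpret wo_rel R using assms(1) by unfold_locales
  have "(a, b) \<in> R" using assms(2) by (auto simp: underS_def)
  then have "underS a \<subseteq> underS b" using underS_incr[OF TRANS ANTISYM] by blast
  moreover from this have "Order_Relation.underS (Restr R (underS b)) a = underS a"
    using assms(2) by (auto simp: underS_def)
  ultimately show ?thesis by auto
qed

lemma Field_Restr_underS: "Well_order R \<Longrightarrow> Field (Restr R (underS R b)) = underS R b"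
  by (simp add: Field_Restr_ofilter wo_rel.underS_ofilter wo_rel_def)

lemma decomposition_class_omega1_bounded:
  fixes F :: "'a metric set"
  defines "W \<equiv> cardSuc natLeq"
  assumes "decomposition_class W F"
  shows "\<exists>a\<in>Field W. decomposition_class (Restr W (underS W a)) F"
proof -
  have C: "Card_order W" and inf: "infinite (Field W)"
    using Cinfinite_cardSuc[OF natLeq_Cinfinite] by (auto simp: W_def cinfinite_def)
  have wo: "Well_order W" using C by (simp add: card_order_on_def)
  interpret wo_rel W using wo by unfold_locales
  have "W \<noteq> {}" using inf by auto
  then have "\<forall>n. \<exists>a\<in>Field W. \<exists>G. decomposition_class (Restr W (underS a)) G
      \<and> r_decomposable (real (Suc n)) F G"
    using assms(2) by (subst (asm) decomposition_class_iff) (auto simp del: of_nat_Suc)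
  then obtain a G where a: "a n \<in> Field W"
      "decomposition_class (Restr W (underS (a n))) (G n)"
      "r_decomposable (real (Suc n)) F (G n)" for n :: nat
    by metis
  have "\<exists>b\<in>Field W. range a \<subseteq> underS b"
    unfolding W_def
  proof (rule cardSuc_UNION_Cinfinite[OF natLeq_Cinfinite])
    show "relChain (cardSuc natLeq) (Order_Relation.underS (cardSuc natLeq))"
      using underS_incr[OF TRANS ANTISYM] by (auto simp: relChain_def W_def)
    show "range a \<subseteq> (\<Union>i\<in>Field (cardSuc natLeq). Order_Relation.underS (cardSuc natLeq) i)"
      using infinite_Card_order_limit[OF C inf a(1)] by (fastforce simp: underS_def W_def)
    show "(card_of (range a), natLeq) \<in> ordLeq"
      using card_of_image card_of_nat ordLeq_ordIso_trans by blast
  qed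
  then obtain b where b: "b \<in> Field W" "range a \<subseteq> underS b" by blast
  have "decomposition_class (Restr W (underS b)) F"
  proof (rule pos)
    show "Restr W (underS b) \<noteq> {}"
      using Field_Restr_underS[OF wo, of b] b(2) by (auto simp: Field_def)
    fix r :: real
    obtain n where n: "r \<le> real (Suc n)" by (meson le_SucI of_nat_le_iff order_trans real_arch_simple lessI less_imp_le)
    have an: "a n \<in> underS b" using b by auto
    then have "decomposition_class (Restr (Restr W (underS b))
        (Order_Relation.underS (Restr W (underS b)) (a n))) (G n)"
      using a(2) by (simp add: Restr_underS_underS[OF wo an])
    then show "\<exists>a\<in>Field (Restr W (underS b)). \<exists>G. decomposition_class
        (Restr (Restr W (underS b)) (Order_Relation.underS (Restr W (underS b)) a)) G
        \<and> r_decomposable r F G"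
      using an r_decomposable_mono[OF a(3) n] by (auto simp: Field_Restr_underS[OF wo])
  qed
  then show ?thesis using b by blast
qed

lemma decomposition_class_imp_omega1:
  fixes F :: "'a metric set"
  assumes "decomposition_class R F" "Well_order R"
  shows "decomposition_class (cardSuc natLeq) F"
  using assms
proof (induction rule: decomposition_class.induct)
  case (zero F)
  then show ?case
    by (intro bounded_decomposition_class cardSuc_Well_order natLeq_Card_order)
next
  case (pos R F)
  show ?case
  proof (rule decomposition_class.pos)
    have "infinite (Field (cardSuc natLeq))"
      using Cinfinite_cardSuc[OF natLeq_Cinfinite] by (simp add: cinfinite_def)
    then show "cardSuc natLeq \<noteq> {}" by auto
    fix r :: real assume "r > 0"
    then obtain G where "decomposition_class (cardSuc natLeq) G" "r_decomposable r F G"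
      using pos.IH[of r] pos.prems Well_order_Restr by blast
    then show "\<exists>a\<in>Field (cardSuc natLeq). \<exists>G.
        decomposition_class (Restr (cardSuc natLeq) (underS (cardSuc natLeq) a)) G \<and>
        r_decomposable r F G"
      using decomposition_class_omega1_bounded by blast
  qed
qed

lemma finite_decomposition_complexityI:
  fixes R :: "'o rel"
  assumes "Well_order R" "decomposition_class R {Y}"
  shows "finite_decomposition_complexity Y"
  unfolding finite_decomposition_complexity_def
  using decomposition_class_imp_omega1[OF assms(2,1)] cardSuc_Well_order[OF natLeq_Card_order]
  by blast

end

theory Submission
  imports Defs
begin

text \<open>The group \<open>T\<close> is an increasing union of virtually abelian groups of finite rank, and
  this can be read off from its sections. Put \<open>s = (23)\<close>. The involutions \<open>s\<close> and \<open>c\<close> generate an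
  infinite dihedral group \<open>D\<close>, whose elements are \<open>s\<^sup>e x\<^sup>m\<close> with \<open>x = cs\<close>; it is closed under
  taking sections, and \<open>t = x\<^sup>-\<^sup>2\<close> lies in it. So all sections of \<open>t\<^sub>v\<close> at level \<open>|v|\<close> are in \<open>D\<close>. The
  automorphisms whose sections at level \<open>n\<close> are all in \<open>D\<close> form a group \<open>M\<^sub>n\<close>
  (\<open>dihedral_at\<close>), the wreath product of \<open>D\<close> with a finite group. These groups increase with
  \<open>n\<close>, and \<open>T\<close> is contained in their union (\<open>T_dihedral_at\<close>).

  Given \<open>r\<close>, the ball of radius \<open>r + 1\<close> of a proper length function on \<open>T\<close> is finite, so it lies in
  some \<open>M\<^sub>n\<close>. Two elements of \<open>T\<close> at distance at most \<open>r + 1\<close> are then in the same right coset of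
  \<open>T \<inter> M\<^sub>n\<close>, and \<open>T\<close> is \<open>r\<close>-decomposable over the family of these cosets. It remains to see
  that this family is in \<open>\<D>\<^sub>k\<close> for a finite \<open>k\<close>. An element of \<open>M\<^sub>n\<close> has an integer coordinate
  for every word \<open>w\<close> of length \<open>n\<close>: the exponent \<open>m\<close> of \<open>x\<close> in the section \<open>s\<^sup>e x\<^sup>m\<close> that arrives at
  \<open>w\<close>. Left multiplication by \<open>b\<close> changes the coordinates exactly by those of \<open>b\<close>, up to sign
  and the order of the words (\<open>coord_comp\<close>), and only finitely many elements have coordinates
  below a given bound (\<open>finite_bounded_coord\<close>). Hence all the cosets embed coarsely into
  \<open>\<int>\<^sup>k\<close>, where \<open>k = 3\<^sup>n\<close>, with the same control functions (\<open>coset_coarse_embedding\<close>). Cutting such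
  a family into slabs, one coordinate after the other, shows that it is in \<open>\<D>\<^sub>k\<close>
  (\<open>coarse_embedding_decomposition_class\<close>).\<close>


section \<open>The infinite dihedral group of sections\<close>

definition half :: "bool \<Rightarrow> int \<Rightarrow> int" where
  "half p m = (if p then m div 2 else (- m) div 2)"

text \<open>The elements \<open>s\<^sup>e x\<^sup>m\<close> of \<open>D\<close>, where \<open>s = (23)\<close> and \<open>x = cs\<close>, are defined by what their
  sections must be. As \<open>x\<^sup>2 = (1, x\<^sup>-\<^sup>1, x)\<close> and \<open>x = (1, s, c)s\<close>, the element \<open>s\<^sup>e x\<^sup>m\<close> moves the
  letters 2 and 3 if and only if exactly one of \<open>e = 1\<close> and \<open>m\<close> odd holds, and
  its sections at these letters have the exponents \<open>m/2\<close> and \<open>-m/2\<close>, rounded down, in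
  an order that depends on this swap, and an initial \<open>s\<close> if and only if \<open>m\<close> is odd.\<close>

fun dihedral :: "bool \<Rightarrow> int \<Rightarrow> word \<Rightarrow> word" where
  "dihedral e m [] = []"
| "dihedral e m (z # u) = (if e \<noteq> odd m then swap23 z else z) #
     triple u (dihedral (odd m) (half (e \<noteq> odd m) m) u) (dihedral (odd m) (half (e = odd m) m) u) z"

lemma swap23_simps [simp]: "swap23 L1 = L1" "swap23 L2 = L3" "swap23 L3 = L2"
  by (auto simp: swap23_def transpose_def)

lemma length_dihedral [simp]: "length (dihedral e m u) = length u"
proof (induction u arbitrary: e m)
  case (Cons z u) then show ?case by (cases z) auto
qed simp

lemma dihedral_id: "dihedral False 0 u = u"
proof (induction u)
  case (Cons z u) then show ?case by (cases z) (auto simp: half_def)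
qed simp

text \<open>This is the multiplication of \<open>D\<close> on the exponents of sections: \<open>p\<close> tells which of the two
  letters is followed, and the second factor meets it after a possible swap by the first.\<close>

lemma half_add:
  "(if odd k then half (p \<noteq> (e \<noteq> odd k)) k - half p m else half (p \<noteq> (e \<noteq> odd k)) k + half p m)
     = half (p \<noteq> (e \<noteq> odd k)) (if e then k - m else k + m)"
  by (cases p; cases e; cases "odd k"; simp add: half_def; presburger)

text \<open>In \<open>D\<close>, \<open>s\<^sup>e x\<^sup>m \<cdot> x\<^sup>k = s\<^sup>e x\<^sup>m\<^sup>+\<^sup>k\<close> and, since conjugation by \<open>s\<close> inverts \<open>x\<close>,
  \<open>s\<^sup>e x\<^sup>m \<cdot> s x\<^sup>k = s\<^sup>e s x\<^sup>k\<^sup>-\<^sup>m\<close>; both factors are functions here, so the first one is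
  innermost.\<close>

lemma dihedral_mult:
  "dihedral e' k (dihedral e m u) = dihedral (e \<noteq> e') (if e' then k - m else k + m) u"
proof (induction u arbitrary: e e' k m)
  case (Cons z u)
  let ?j = "if e' then k - m else k + m"
  have odd: "odd ?j \<longleftrightarrow> odd k \<noteq> odd m" by simp
  show ?case
  proof (cases z)
    case L1
    then show ?thesis using odd by auto
  next
    case L2
    then show ?thesis
      using half_add[of k "e \<noteq> odd m" e' m] odd
      by (cases "odd m"; cases "odd k"; cases e; cases e'; simp add: Cons.IH)
  next
    case L3
    then show ?thesis
      using half_add[of k "e = odd m" e' m] odd
      by (cases "odd m"; cases "odd k"; cases e; cases e'; simp add: Cons.IH)
  qed
qed simp

lemma dihedral_inverse:
  "\<exists>e' m'. (\<forall>u. dihedral e' m' (dihedral e m u) = u) \<and> (\<forall>u. dihedral e m (dihedral e' m' u) = u)"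
proof (intro exI conjI allI)
  fix u
  show "dihedral e (if e then m else - m) (dihedral e m u) = u"
    "dihedral e m (dihedral e (if e then m else - m) u) = u"
    by (auto simp: dihedral_mult dihedral_id)
qed

text \<open>The parametrisation of \<open>D\<close> is faithful, so exponents are well defined. If \<open>s\<^sup>e x\<^sup>m\<close> is
  trivial, then so are its sections, whose exponents are about half as large. Odd \<open>m\<close> is excluded at
  the next level: both sections then begin with \<open>s\<close>, so their exponents would have to be odd, but they
  add up to \<open>-1\<close>.\<close>

lemma dihedral_eq_id:
  assumes "\<And>u. dihedral e m u = u"
  shows "\<not> e \<and> m = 0"
  using assms
proof (induction "nat \<bar>m\<bar>" arbitrary: e m rule: less_induct)
  case less
  \<comment> \<open>the action on the first level\<close>
  have parity: "e' = odd m'" if "\<And>u. dihedral e' m' u = u" for e' m'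
    using that[of "[L2]"] by (auto split: if_splits)
  have e: "e = odd m" using less.prems by (rule parity)
  have 2: "dihedral (odd m) ((- m) div 2) u = u" for u
    using less.prems[of "L2 # u"] e by (simp add: half_def)
  have 3: "dihedral (odd m) (m div 2) u = u" for u
    using less.prems[of "L3 # u"] e by (simp add: half_def)
  have "even m" using parity[OF 2] parity[OF 3] by presburger
  moreover have "m = 0" if "even m"
  proof (rule ccontr)
    assume "m \<noteq> 0"
    then have "nat \<bar>m div 2\<bar> < nat \<bar>m\<bar>" using that by (auto elim!: evenE)
    from less.hyps[OF this 3] have "m div 2 = 0" by blast
    then show False using that \<open>m \<noteq> 0\<close> by presburger
  qed
  ultimately show ?case using e by auto
qed

lemma dihedral_inject: "dihedral e m = dihedral e' m' \<longleftrightarrow> e = e' \<and> m = m'"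
proof
  assume eq: "dihedral e m = dihedral e' m'"
  have "dihedral e (if e then m else - m) (dihedral e' m' u) = u" for u
    by (simp add: eq[symmetric] dihedral_mult dihedral_id)
  then have "dihedral (e' \<noteq> e) (if e then m - m' else m' - m) u = u" for u
    by (cases e) (simp_all add: dihedral_mult)
  from dihedral_eq_id[OF this] show "e = e' \<and> m = m'" by (auto split: if_splits)
qed simp

lemma dihedral_Cons: "\<exists>e' m'. \<forall>u. dihedral e m (z # u) = dihedral e m [z] @ dihedral e' m' u"
proof (cases z)
  case L1 then show ?thesis by (intro exI[of _ False] exI[of _ 0]) (simp add: dihedral_id)
qed auto

lemma rooted_swap23_dihedral: "rooted swap23 u = dihedral True 0 u"
proof (cases u)
  case (Cons z w) then show ?thesis by (cases z) (auto simp: rooted_def dihedral_id half_def)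
qed (simp add: rooted_def)

lemma c_elem_dihedral: "c_elem u = dihedral True (- 1) u"
proof (induction u)
  case (Cons z u)
  have "rooted id u = u" by (simp add: rooted_def wreath_id)
  then show ?case using Cons by (cases z) (auto simp: c_elem_def rooted_swap23_dihedral half_def)
qed (simp add: c_elem_def)

lemma t_root_dihedral: "t_root = dihedral False (- 2)"
  by (simp add: fun_eq_iff t_root_def tree_aut_simps c_elem_dihedral rooted_swap23_dihedral dihedral_mult)

section \<open>Automorphisms with dihedral sections\<close>

definition dihedral_at :: "nat \<Rightarrow> (word \<Rightarrow> word) set" where
  "dihedral_at n = {g. bij g \<and> (\<forall>v. length (g v) = length v) \<and>
     (\<forall>v. length v = n \<longrightarrow> (\<exists>e m. \<forall>u. g (v @ u) = g v @ dihedral e m u))}"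

lemma dihedral_atE:
  assumes "g \<in> dihedral_at n" "length v = n"
  obtains e m where "\<And>u. g (v @ u) = g v @ dihedral e m u"
  using assms unfolding dihedral_at_def by blast

lemma dihedral_at_bij: "g \<in> dihedral_at n \<Longrightarrow> bij g"
  and dihedral_at_length: "g \<in> dihedral_at n \<Longrightarrow> length (g v) = length v"
  by (auto simp: dihedral_at_def)

lemma dihedral_at_id: "id \<in> dihedral_at n"
  unfolding dihedral_at_def by (auto intro!: exI[of _ False] exI[of _ 0] simp: dihedral_id)

lemma dihedral_at_comp:
  assumes b: "b \<in> dihedral_at n" and h: "h \<in> dihedral_at n"
  shows "h \<circ> b \<in> dihedral_at n"
  unfolding dihedral_at_def
proof (intro CollectI conjI allI impI)
  fix v :: word assume v: "length v = n"
  obtain e m where 1: "\<And>u. b (v @ u) = b v @ dihedral e m u" using dihedral_atE[OF b v] by blast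
  have "length (b v) = n" using v b by (simp add: dihedral_at_length)
  then obtain e' k where 2: "\<And>u. h (b v @ u) = h (b v) @ dihedral e' k u" using dihedral_atE[OF h] by blast
  show "\<exists>e m. \<forall>u. (h \<circ> b) (v @ u) = (h \<circ> b) v @ dihedral e m u"
    by (auto simp: 1 2 dihedral_mult)
qed (use b h in \<open>auto simp: dihedral_at_length intro: bij_comp dihedral_at_bij\<close>)

lemma dihedral_at_inverse:
  assumes g: "g \<in> dihedral_at n" and gh: "g \<circ> h = id"
  shows "h \<in> dihedral_at n"
  unfolding dihedral_at_def
proof (intro CollectI conjI allI impI)
  have *: "g (h v) = v" for v using gh by (simp add: fun_eq_iff)
  have "h = inv_into UNIV g" using dihedral_at_bij[OF g] * by (metis bij_inv_eq_iff ext)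
  then show "bij h" using dihedral_at_bij[OF g] by (simp add: bij_imp_bij_inv)
  have inj: "g a = g b \<Longrightarrow> a = b" for a b using dihedral_at_bij[OF g] by (auto dest: bij_is_inj injD)
  show len: "length (h v) = length v" for v
    using dihedral_at_length[OF g, of "h v"] by (simp add: *)
  fix v :: word assume v: "length v = n"
  obtain e m where 1: "\<And>u. g (h v @ u) = g (h v) @ dihedral e m u"
    using dihedral_atE[OF g, of "h v"] v len by auto
  obtain e' m' where 2: "\<And>u. dihedral e m (dihedral e' m' u) = u" using dihedral_inverse by blast
  have "h (v @ u) = h v @ dihedral e' m' u" for u
    by (rule inj) (simp add: 1 2 *)
  then show "\<exists>e m. \<forall>u. h (v @ u) = h v @ dihedral e m u" by blast
qed

lemma dihedral_at_Suc: "dihedral_at n \<subseteq> dihedral_at (Suc n)"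
proof
  fix g assume g: "g \<in> dihedral_at n"
  show "g \<in> dihedral_at (Suc n)"
    unfolding dihedral_at_def
  proof (intro CollectI conjI allI impI)
    fix v :: word assume "length v = Suc n"
    then obtain v' z where v: "v = v' @ [z]" "length v' = n"
      by (metis length_Suc_conv_rev)
    obtain e m where 1: "\<And>u. g (v' @ u) = g v' @ dihedral e m u" using dihedral_atE[OF g v(2)] by blast
    obtain e' m' where 2: "\<And>u. dihedral e m (z # u) = dihedral e m [z] @ dihedral e' m' u" using dihedral_Cons by blast
    show "\<exists>e m. \<forall>u. g (v @ u) = g v @ dihedral e m u"
      using 1 2 v by (metis append.assoc append_Cons append_Nil)
  qed (use g in \<open>auto simp: dihedral_at_length dihedral_at_bij\<close>)
qed

lemma dihedral_at_mono: "m \<le> n \<Longrightarrow> dihedral_at m \<subseteq> dihedral_at n"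
  by (rule lift_Suc_mono_le[of dihedral_at, OF dihedral_at_Suc])

lemma t_elem_dihedral_at: "t_elem v \<in> dihedral_at (length v)"
proof (induction v)
  case Nil
  have b: "bij t_root"
    using t_elem_in_mother_group[of "[]"] mother_group_subgroup
    by (auto dest!: subgroup.subset simp: tree_aut_def)
  show ?case unfolding dihedral_at_def using b by (auto simp: t_root_dihedral)
next
  case (Cons x v)
  have b: "bij (t_elem (x # v))"
    using t_elem_in_mother_group[of "x # v"] mother_group_subgroup
    by (auto dest!: subgroup.subset simp: tree_aut_def)
  show ?case unfolding dihedral_at_def
  proof (intro CollectI conjI allI impI b)
    show "length (t_elem (x # v) w) = length w" for w
      using dihedral_at_length[OF Cons] by (cases w) auto
    fix w :: word assume "length w = length (x # v)"
    then obtain y w' where w: "w = y # w'" "length w' = length v" by (cases w) auto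
    obtain e m where 1: "\<And>u. t_elem v (w' @ u) = t_elem v w' @ dihedral e m u"
      using dihedral_atE[OF Cons w(2)] by blast
    show "\<exists>e m. \<forall>u. t_elem (x # v) (w @ u) = t_elem (x # v) w @ dihedral e m u"
    proof (cases "y = x")
      case True then show ?thesis using 1 w by auto
    next
      case False then show ?thesis
        using w by (intro exI[of _ False] exI[of _ 0]) (simp add: dihedral_id)
    qed
  qed
qed

text \<open>As the groups \<open>M\<^sub>n\<close> increase, it is enough that each generator lies in one of them.\<close>

lemma T_dihedral_at:
  assumes "g \<in> carrier T_group"
  shows "\<exists>n. g \<in> dihedral_at n"
proof -
  interpret group tree_aut by (rule tree_aut_group)
  have r: "range t_elem \<subseteq> carrier tree_aut"
    using t_elem_in_mother_group mother_group_subgroup by (auto dest: subgroup.subset)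
  from assms have "g \<in> generate tree_aut (range t_elem)" by (simp add: T_group_carrier)
  then show ?thesis
  proof induction
    case one then show ?case unfolding tree_aut_simps using dihedral_at_id by blast
  next
    case (incl h) then show ?case using t_elem_dihedral_at by blast
  next
    case (inv h)
    then obtain v where h: "h = t_elem v" by blast
    have "h \<in> carrier tree_aut" using inv r by blast
    then have "inv\<^bsub>tree_aut\<^esub> h \<otimes>\<^bsub>tree_aut\<^esub> h = \<one>\<^bsub>tree_aut\<^esub>" by simp
    then have "h \<circ> inv\<^bsub>tree_aut\<^esub> h = id" by (simp add: tree_aut_simps)
    then show ?case using dihedral_at_inverse t_elem_dihedral_at h by blast
  next
    case (eng g h)
    then obtain a b where ab: "g \<in> dihedral_at a" "h \<in> dihedral_at b" by blast
    then have "g \<in> dihedral_at (max a b)" "h \<in> dihedral_at (max a b)"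
      using dihedral_at_mono[of a "max a b"] dihedral_at_mono[of b "max a b"] by auto
    then show ?case unfolding tree_aut_simps using dihedral_at_comp by blast
  qed
qed

section \<open>Integer coordinates\<close>

text \<open>The coordinates of \<open>g\<close> are indexed by the words \<open>w\<close> at which sections arrive, not by
  the words \<open>v\<close> with \<open>g v = w\<close> at which they are taken: multiplication from the left permutes the
  latter, so that with the other indexing a fixed left factor could change a coordinate by any
  amount.\<close>

definition coord :: "word \<Rightarrow> (word \<Rightarrow> word) \<Rightarrow> int" where
  "coord w g = (THE m. \<exists>v e. \<forall>u. g (v @ u) = w @ dihedral e m u)"

lemma coord_eq:
  assumes "bij g" "\<And>u. g (v @ u) = w @ dihedral e m u"
  shows "coord w g = m"
  unfolding coord_def
proof (rule the_equality)
  show "\<exists>v e. \<forall>u. g (v @ u) = w @ dihedral e m u" using assms by blast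
  fix m' assume "\<exists>v e. \<forall>u. g (v @ u) = w @ dihedral e m' u"
  then obtain v' e' where *: "\<And>u. g (v' @ u) = w @ dihedral e' m' u" by blast
  have "g v' = g v" using *[of "[]"] assms(2)[of "[]"] by simp
  then have "v' = v" using assms(1) by (auto dest: bij_is_inj injD)
  then have "dihedral e' m' = dihedral e m" using * assms(2) by (auto simp: fun_eq_iff)
  then show "m' = m" by (simp add: dihedral_inject)
qed

text \<open>The section of \<open>h \<circ> b\<close> that arrives at \<open>h v\<close> is the section of \<open>b\<close> that arrives at \<open>v\<close>,
  followed by that of \<open>h\<close>, and the product in \<open>D\<close> adds the exponents or subtracts them.
  The identity serves both directions of a coarse embedding: it bounds the change of coordinates
  by \<open>b\<close>, and \<open>b\<close> by the change of coordinates.\<close>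

lemma coord_comp:
  assumes b: "b \<in> dihedral_at n" and h: "h \<in> dihedral_at n" and v: "length v = n"
  shows "\<bar>coord (h v) (h \<circ> b) - coord (h v) h\<bar> = \<bar>coord v b\<bar>"
proof -
  obtain v0 where v0: "b v0 = v" using dihedral_at_bij[OF b] by (metis bij_pointE)
  then have "length v0 = n" using dihedral_at_length[OF b] v by metis
  then obtain e m where 1: "\<And>u. b (v0 @ u) = v @ dihedral e m u"
    using dihedral_atE[OF b] v0 by metis
  obtain e' k where 2: "\<And>u. h (v @ u) = h v @ dihedral e' k u" using dihedral_atE[OF h v] by blast
  have "(h \<circ> b) (v0 @ u) = h v @ dihedral (e \<noteq> e') (if e' then k - m else k + m) u" for u
    by (simp add: 1 2 dihedral_mult)
  then have "coord (h v) (h \<circ> b) = (if e' then k - m else k + m)"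
    using b h by (intro coord_eq[where e = "e \<noteq> e'"]) (auto intro: bij_comp dihedral_at_bij)
  moreover have "coord (h v) h = k" using h 2 by (intro coord_eq) (auto intro: dihedral_at_bij)
  moreover have "coord v b = m" using b 1 by (intro coord_eq) (auto intro: dihedral_at_bij)
  ultimately show ?thesis by auto
qed

lemma finite_UNIV_letter: "finite (UNIV :: letter set)"
proof -
  have "(UNIV :: letter set) = {L1, L2, L3}" using letter.exhaust by auto
  then show ?thesis by (metis finite.emptyI finite_insert)
qed

lemma finite_words: "finite {v :: word. length v = n}" "finite {v :: word. length v \<le> n}"
  using finite_lists_length_eq[OF finite_UNIV_letter, of n]
    finite_lists_length_le[OF finite_UNIV_letter, of n] by simp_all

text \<open>An element is determined by its values on the words of length at most \<open>n\<close> and by its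
  sections at level \<open>n\<close>, and bounded exponents leave finitely many choices for both.\<close>

lemma finite_bounded_coord:
  "finite {b \<in> dihedral_at n. \<forall>v. length v = n \<longrightarrow> \<bar>coord v b\<bar> \<le> L}"
proof -
  let ?E = "{b \<in> dihedral_at n. \<forall>v. length v = n \<longrightarrow> \<bar>coord v b\<bar> \<le> L}"
  let ?W = "{v :: word. length v \<le> n}" and ?V = "{v :: word. length v = n}"
  let ?S = "(\<lambda>(e, m). dihedral e m) ` (UNIV \<times> {- L..L})"
  define \<Phi> where "\<Phi> b = (restrict b ?W, restrict (\<lambda>v u. drop n (b (v @ u))) ?V)"
    for b :: "word \<Rightarrow> word"
  have "\<Phi> ` ?E \<subseteq> (?W \<rightarrow>\<^sub>E ?W) \<times> (?V \<rightarrow>\<^sub>E ?S)"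
  proof (rule image_subsetI)
    fix b assume "b \<in> ?E"
    then have b: "b \<in> dihedral_at n" and L: "\<And>v. length v = n \<Longrightarrow> \<bar>coord v b\<bar> \<le> L" by auto
    have "(\<lambda>u. drop n (b (v @ u))) \<in> ?S" if v: "length v = n" for v
    proof -
      obtain e m where 1: "\<And>u. b (v @ u) = b v @ dihedral e m u" using dihedral_atE[OF b v] by blast
      have len: "length (b v) = n" using dihedral_at_length[OF b] v by simp
      have "coord (b v) b = m" using b 1 by (intro coord_eq) (auto intro: dihedral_at_bij)
      then have "m \<in> {- L..L}" using L[OF len] by auto
      moreover have "(\<lambda>u. drop n (b (v @ u))) = dihedral e m" using 1 len by auto
      ultimately show ?thesis by auto
    qed
    then show "\<Phi> b \<in> (?W \<rightarrow>\<^sub>E ?W) \<times> (?V \<rightarrow>\<^sub>E ?S)"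
      using dihedral_at_length[OF b] by (simp add: \<Phi>_def restrict_PiE_iff)
  qed
  moreover have "finite ((?W \<rightarrow>\<^sub>E ?W) \<times> (?V \<rightarrow>\<^sub>E ?S))"
    by (intro finite_cartesian_product finite_PiE finite_words finite_imageI) auto
  ultimately have "finite (\<Phi> ` ?E)" using finite_subset by blast
  moreover have "inj_on \<Phi> ?E"
  proof (rule inj_onI, rule ext)
    fix a b w assume ab: "a \<in> ?E" "b \<in> ?E" and eq: "\<Phi> a = \<Phi> b"
    have short: "a v = b v" if "length v \<le> n" for v
      using eq that by (auto simp: \<Phi>_def fun_eq_iff restrict_def split: if_splits)
    show "a w = b w"
    proof (cases "length w \<le> n")
      case False
      define v u where "v = take n w" and "u = drop n w"
      have v: "length v = n" "w = v @ u" using False by (auto simp: v_def u_def)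
      have *: "g w = g v @ drop n (g w)" if g: "g \<in> dihedral_at n" for g
        using dihedral_atE[OF g v(1)] dihedral_at_length[OF g] v
        by (metis append_eq_conv_conj)
      have "drop n (a w) = drop n (b w)"
        using eq v by (auto simp: \<Phi>_def fun_eq_iff restrict_def split: if_splits)
      then show ?thesis using *[of a] *[of b] ab short[of v] v(1) by simp
    qed (rule short)
  qed
  ultimately show ?thesis by (rule finite_imageD)
qed


section \<open>Families that embed coarsely into a power of the integers\<close>

text \<open>The control functions \<open>S\<close> and \<open>B\<close> are parameters, so that they can be the same for all
  sets of a family while the maps \<open>f\<close> differ.\<close>


definition coarse_embedding ::
    "'a metric \<Rightarrow> 'i set \<Rightarrow> (real \<Rightarrow> int) \<Rightarrow> (int \<Rightarrow> real) \<Rightarrow> 'a set \<Rightarrow> ('i \<Rightarrow> 'a \<Rightarrow> int) \<Rightarrow> bool" where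
  "coarse_embedding M I S B U f \<longleftrightarrow>
     (\<forall>i\<in>I. \<forall>r. \<forall>x\<in>U. \<forall>y\<in>U. mdist M x y \<le> r \<longrightarrow> \<bar>f i x - f i y\<bar> \<le> S r) \<and>
     (\<forall>L. \<forall>x\<in>U. \<forall>y\<in>U. (\<forall>i\<in>I. \<bar>f i x - f i y\<bar> \<le> L) \<longrightarrow> mdist M x y \<le> B L)"

text \<open>Strictness of the bound on the infimum is the reason for the gap between \<open>r\<close> and \<open>s\<close>.\<close>

lemma r_disjointI:
  assumes "r < s"
    and "\<And>U V x y. U \<in> \<U> \<Longrightarrow> V \<in> \<U> \<Longrightarrow> x \<in> U \<Longrightarrow> y \<in> V \<Longrightarrow> mdist M x y \<le> s \<Longrightarrow> U = V"
  shows "r_disjoint M r \<U>"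
  unfolding r_disjoint_def
proof (intro ballI impI)
  fix U V assume "U \<in> \<U>" "V \<in> \<U>" "U \<noteq> V"
  then have "s \<le> mdist M x y" if "x \<in> U" "y \<in> V" for x y
    using assms(2) that by (meson linear)
  then have "ereal s \<le> (INF (x, y)\<in>U \<times> V. ereal (mdist M x y))"
    by (intro INF_greatest) auto
  then show "(INF (x, y)\<in>U \<times> V. ereal (mdist M x y)) > ereal r"
    using assms(1) by (meson ereal_less(2) less_ereal.simps(1) order_less_le_trans)
qed

text \<open>Slabs of thickness \<open>N\<close> whose numbers have the same parity are separated by a whole slab, which
  no step of length \<open>s\<close> can cross.\<close>

lemma r_disjoint_level_sets:
  fixes f :: "'a \<Rightarrow> int"
  assumes "N > 0" "r < s"
    and "\<And>x y. x \<in> U \<Longrightarrow> y \<in> U \<Longrightarrow> mdist M x y \<le> s \<Longrightarrow> \<bar>f x - f y\<bar> < N"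
  shows "r_disjoint M r (range (\<lambda>q. {x \<in> U. f x div N = 2 * q + j}))"
proof (rule r_disjointI[OF assms(2)])
  have aux: "q \<le> q'" if "x \<in> U" "y \<in> U" "mdist M x y \<le> s"
    "f x div N = 2 * q + j" "f y div N = 2 * q' + j" for x y q q'
  proof (rule ccontr)
    assume "\<not> q \<le> q'"
    then have "f y div N + 1 < f x div N" using that by simp
    then have "N * (f y div N + 2) \<le> N * (f x div N)" using assms(1) by simp
    moreover have "N * (f x div N) \<le> f x" "f y < N * (f y div N) + N"
      using assms(1) by (simp add: algebra_simps minus_mod_eq_mult_div[symmetric])+
    ultimately have "f x - f y > N" by (simp add: algebra_simps)
    then show False using assms(3)[of x y] that by simp
  qed
  fix A B x y
  assume A: "A \<in> range (\<lambda>q. {x \<in> U. f x div N = 2 * q + j})"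
    and B: "B \<in> range (\<lambda>q. {x \<in> U. f x div N = 2 * q + j})"
    and *: "x \<in> A" "y \<in> B" "mdist M x y \<le> s"
  obtain a b where ab: "A = {x \<in> U. f x div N = 2 * a + j}" "B = {x \<in> U. f x div N = 2 * b + j}"
    using A B by blast
  have "a \<le> b" "b \<le> a" using aux[of x y a b] aux[of y x b a] * ab by (auto simp: mdist_commute)
  then show "A = B" using ab by simp
qed

lemma natLeq_on_Suc_class:
  assumes "\<And>r. r > 0 \<Longrightarrow> \<exists>G. decomposition_class (natLeq_on n) G \<and> r_decomposable r F G"
  shows "decomposition_class (natLeq_on (Suc n)) F"
proof (rule decomposition_class.pos)
  show "natLeq_on (Suc n) \<noteq> {}" by auto
  fix r :: real assume "r > 0"
  then obtain G where G: "decomposition_class (natLeq_on n) G" "r_decomposable r F G"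
    using assms by blast
  have "Restr (natLeq_on (Suc n)) (underS (natLeq_on (Suc n)) n) = natLeq_on n"
    by (auto simp: underS_def)
  then show "\<exists>a\<in>Field (natLeq_on (Suc n)). \<exists>G.
      decomposition_class (Restr (natLeq_on (Suc n)) (underS (natLeq_on (Suc n)) a)) G \<and> r_decomposable r F G"
    using G by (intro bexI[of _ n]) (auto simp: Field_natLeq_on)
qed

text \<open>On a slab of the coordinate \<open>i\<close> that coordinate oscillates by at most the thickness \<open>N\<close>, so the
  other coordinates suffice for a coarse embedding of the slab, with \<open>B\<close> adjusted to \<open>N\<close>. As \<open>N\<close>
  depends on \<open>r\<close>, the induction is over all \<open>B\<close> and all families of sets.\<close>

lemma coarse_embedding_decomposition_class:
  fixes M :: "'a metric" and I :: "'i set"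
  assumes "finite I" and "\<And>U. U \<in> \<U> \<Longrightarrow> U \<subseteq> mspace M"
    and "\<And>U. U \<in> \<U> \<Longrightarrow> \<exists>f. coarse_embedding M I S B U f"
  shows "decomposition_class (natLeq_on (card I)) (submetric M ` \<U>)"
  using assms
proof (induction I arbitrary: B \<U> rule: finite_induct)
  case empty
  have "mdist M x y \<le> B 0" if "U \<in> \<U>" "x \<in> U" "y \<in> U" for U x y
    using empty.prems(2)[OF that(1)] that by (auto simp: coarse_embedding_def)
  then have "bounded_family (submetric M ` \<U>)"
    unfolding bounded_family_def by (intro exI[of _ "B 0"]) auto
  then show ?case by (simp add: decomposition_class.zero)
next
  case (insert i I)
  have "decomposition_class (natLeq_on (Suc (card I))) (submetric M ` \<U>)"
  proof (rule natLeq_on_Suc_class)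
    fix r :: real
    \<comment> \<open>a step of length \<open>r + 1\<close> changes coordinates by less than \<open>N\<close>\<close>
    define N where "N = max 1 (S (r + 1) + 1)"
    have N: "N > 0" by (simp add: N_def)
    define \<V> where "\<V> = {V. V \<subseteq> mspace M \<and> (\<exists>f. coarse_embedding M I S (\<lambda>L. B (max L N)) V f)}"
    have "decomposition_class (natLeq_on (card I)) (submetric M ` \<V>)"
      by (rule insert.IH) (auto simp: \<V>_def)
    moreover have "r_decomposable r (submetric M ` \<U>) (submetric M ` \<V>)"
      unfolding r_decomposable_def
    proof
      fix Z assume "Z \<in> submetric M ` \<U>"
      then obtain U where U: "U \<in> \<U>" "Z = submetric M U" by blast
      have UM: "U \<subseteq> mspace M" using insert.prems(1) U by blast
      obtain f where f: "coarse_embedding M (insert i I) S B U f" using insert.prems(2) U by blast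
      define \<P> where "\<P> j = range (\<lambda>q. {x \<in> U. f i x div N = 2 * q + j})" for j
      have "mspace Z = \<Union>(\<P> 0) \<union> \<Union>(\<P> 1)"
      proof -
        have "x \<in> \<Union>(\<P> 0) \<union> \<Union>(\<P> 1)" if "x \<in> U" for x
        proof (cases "even (f i x div N)")
          case True
          then obtain q where "f i x div N = 2 * q + 0" by (auto elim: evenE)
          then show ?thesis using that unfolding \<P>_def by blast
        next
          case False
          then obtain q where "f i x div N = 2 * q + 1" by (auto elim: oddE)
          then show ?thesis using that unfolding \<P>_def by blast
        qed
        moreover have "\<Union>(\<P> 0) \<union> \<Union>(\<P> 1) \<subseteq> U" by (auto simp: \<P>_def)
        moreover have "mspace Z = U" using U UM by auto
        ultimately show ?thesis by blast
      qed
      moreover have "r_disjoint Z r (\<P> j)" for j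
        unfolding \<P>_def
      proof (rule r_disjoint_level_sets[OF N, of _ "r + 1"])
        fix x y assume "x \<in> U" "y \<in> U" "mdist Z x y \<le> r + 1"
        then have "\<bar>f i x - f i y\<bar> \<le> S (r + 1)"
          using f U by (auto simp: coarse_embedding_def)
        then show "\<bar>f i x - f i y\<bar> < N" by (simp add: N_def)
      qed simp
      moreover have "submetric Z V \<in> submetric M ` \<V>" if V: "V \<in> \<P> 0 \<union> \<P> 1" for V
      proof -
        have VU: "V \<subseteq> U" using V by (auto simp: \<P>_def)
        obtain k where k: "\<And>x. x \<in> V \<Longrightarrow> f i x div N = k" using V by (auto simp: \<P>_def)
        have osc: "\<bar>f i x - f i y\<bar> \<le> N" if "x \<in> V" "y \<in> V" for x y
        proof -
          have "f i z = N * k + f i z mod N" "0 \<le> f i z mod N" "f i z mod N < N" if "z \<in> V" for z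
            using N k[OF that] mult_div_mod_eq[of N "f i z"] by auto
          from this[OF that(1)] this[OF that(2)] show ?thesis by linarith
        qed
        have "coarse_embedding M I S (\<lambda>L. B (max L N)) V f"
          unfolding coarse_embedding_def
        proof (intro conjI ballI allI impI)
          fix j r x y assume "j \<in> I" "x \<in> V" "y \<in> V" "mdist M x y \<le> r"
          then show "\<bar>f j x - f j y\<bar> \<le> S r" using f VU unfolding coarse_embedding_def by blast
        next
          fix L x y assume xy: "x \<in> V" "y \<in> V" and "\<forall>j\<in>I. \<bar>f j x - f j y\<bar> \<le> L"
          then have "\<forall>j\<in>insert i I. \<bar>f j x - f j y\<bar> \<le> max L N" using osc[OF xy] by auto
          then show "mdist M x y \<le> B (max L N)"
            using f VU xy unfolding coarse_embedding_def by blast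
        qed
        moreover have "submetric Z V = submetric M V" using U VU by (simp add: Int_absorb1)
        ultimately show ?thesis using VU UM by (auto simp: \<V>_def)
      qed
      ultimately show "\<exists>\<U>\<^sub>0 \<U>\<^sub>1. mspace Z = \<Union>\<U>\<^sub>0 \<union> \<Union>\<U>\<^sub>1 \<and> r_disjoint Z r \<U>\<^sub>0 \<and> r_disjoint Z r \<U>\<^sub>1 \<and>
          (\<forall>V \<in> \<U>\<^sub>0 \<union> \<U>\<^sub>1. submetric Z V \<in> submetric M ` \<V>)"
        by (intro exI[of _ "\<P> 0"] exI[of _ "\<P> 1"] conjI ballI)
    qed
    ultimately show "\<exists>G. decomposition_class (natLeq_on (card I)) G \<and> r_decomposable r (submetric M ` \<U>) G"
      by blast
  qed
  then show ?case using insert.hyps by simp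
qed

section \<open>Cosets of the level subgroups of \<open>T\<close>\<close>

lemma T_group_mult: "g \<otimes>\<^bsub>T_group\<^esub> h = h \<circ> g"
  by (simp add: T_group_def mother_group_def tree_aut_simps)

lemma T_group_one: "\<one>\<^bsub>T_group\<^esub> = id"
  by (simp add: T_group_def mother_group_def tree_aut_simps)

lemma dihedral_at_T_mult:
  "g \<in> dihedral_at n \<Longrightarrow> h \<in> dihedral_at n \<Longrightarrow> g \<otimes>\<^bsub>T_group\<^esub> h \<in> dihedral_at n"
  unfolding T_group_mult by (rule dihedral_at_comp)

lemma dihedral_at_T_inv:
  assumes "g \<in> carrier T_group" "g \<in> dihedral_at n"
  shows "inv\<^bsub>T_group\<^esub> g \<in> dihedral_at n"
proof -
  interpret group T_group by (rule T_group_group)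
  have "g \<circ> inv\<^bsub>T_group\<^esub> g = id"
    using l_inv[OF assms(1)] unfolding T_group_mult T_group_one .
  then show ?thesis using dihedral_at_inverse assms(2) by blast
qed

text \<open>In the metric \<open>l (g h\<^sup>-\<^sup>1)\<close>, elements at distance at most \<open>r\<close> differ by a left factor from the
  ball of radius \<open>r\<close>. Hence it is the right cosets \<open>(T \<inter> M\<^sub>n) k\<close> that are far from each other.\<close>

definition coset_of :: "nat \<Rightarrow> (word \<Rightarrow> word) \<Rightarrow> (word \<Rightarrow> word) set" where
  "coset_of n k = {g \<in> carrier T_group. g \<otimes>\<^bsub>T_group\<^esub> inv\<^bsub>T_group\<^esub> k \<in> dihedral_at n}"

lemma T_quotient:
  assumes "x \<in> carrier T_group" "y \<in> carrier T_group" "k \<in> carrier T_group"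
  shows "(x \<otimes>\<^bsub>T_group\<^esub> inv\<^bsub>T_group\<^esub> y) \<otimes>\<^bsub>T_group\<^esub> (y \<otimes>\<^bsub>T_group\<^esub> inv\<^bsub>T_group\<^esub> k)
    = x \<otimes>\<^bsub>T_group\<^esub> inv\<^bsub>T_group\<^esub> k"
proof -
  interpret group T_group by (rule T_group_group)
  have "inv\<^bsub>T_group\<^esub> y \<otimes>\<^bsub>T_group\<^esub> (y \<otimes>\<^bsub>T_group\<^esub> inv\<^bsub>T_group\<^esub> k) = inv\<^bsub>T_group\<^esub> k"
    using assms by (simp add: m_assoc[symmetric])
  then show ?thesis using assms by (simp add: m_assoc)
qed

lemma T_quotient_inv:
  assumes "x \<in> carrier T_group" "y \<in> carrier T_group"
  shows "inv\<^bsub>T_group\<^esub> (x \<otimes>\<^bsub>T_group\<^esub> inv\<^bsub>T_group\<^esub> y) = y \<otimes>\<^bsub>T_group\<^esub> inv\<^bsub>T_group\<^esub> x"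
proof -
  interpret group T_group by (rule T_group_group)
  show ?thesis using assms by (simp add: inv_mult_group)
qed

lemma quotient_in_dihedral_at:
  assumes x: "x \<in> coset_of n k" and y: "y \<in> coset_of n k" and k: "k \<in> carrier T_group"
  shows "x \<otimes>\<^bsub>T_group\<^esub> inv\<^bsub>T_group\<^esub> y \<in> dihedral_at n"
proof -
  interpret group T_group by (rule T_group_group)
  have x': "x \<in> carrier T_group" "x \<otimes>\<^bsub>T_group\<^esub> inv\<^bsub>T_group\<^esub> k \<in> dihedral_at n"
    and y': "y \<in> carrier T_group" "y \<otimes>\<^bsub>T_group\<^esub> inv\<^bsub>T_group\<^esub> k \<in> dihedral_at n"
    using x y by (auto simp: coset_of_def)
  have "inv\<^bsub>T_group\<^esub> (y \<otimes>\<^bsub>T_group\<^esub> inv\<^bsub>T_group\<^esub> k) \<in> dihedral_at n"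
    using y' k by (intro dihedral_at_T_inv) auto
  then have "k \<otimes>\<^bsub>T_group\<^esub> inv\<^bsub>T_group\<^esub> y \<in> dihedral_at n" by (simp add: T_quotient_inv y' k)
  from dihedral_at_T_mult[OF x'(2) this] show ?thesis by (simp only: T_quotient x' y' k)
qed

lemma coset_of_eqI:
  assumes "x \<in> coset_of n k" "y \<in> coset_of n k'" "k \<in> carrier T_group" "k' \<in> carrier T_group"
    and xy: "x \<otimes>\<^bsub>T_group\<^esub> inv\<^bsub>T_group\<^esub> y \<in> dihedral_at n"
  shows "coset_of n k = coset_of n k'"
proof -
  interpret group T_group by (rule T_group_group)
  have trans: "a \<otimes>\<^bsub>T_group\<^esub> inv\<^bsub>T_group\<^esub> c \<in> dihedral_at n"
    if "a \<in> carrier T_group" "b \<in> carrier T_group" "c \<in> carrier T_group"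
      "a \<otimes>\<^bsub>T_group\<^esub> inv\<^bsub>T_group\<^esub> b \<in> dihedral_at n" "b \<otimes>\<^bsub>T_group\<^esub> inv\<^bsub>T_group\<^esub> c \<in> dihedral_at n"
    for a b c
    using dihedral_at_T_mult[OF that(4,5)] T_quotient[OF that(1-3)] by simp
  have sym: "b \<otimes>\<^bsub>T_group\<^esub> inv\<^bsub>T_group\<^esub> a \<in> dihedral_at n"
    if "a \<in> carrier T_group" "b \<in> carrier T_group"
      "a \<otimes>\<^bsub>T_group\<^esub> inv\<^bsub>T_group\<^esub> b \<in> dihedral_at n" for a b
    using dihedral_at_T_inv[OF _ that(3)] T_quotient_inv[OF that(1,2)] that by simp
  have x: "x \<in> carrier T_group" "x \<otimes>\<^bsub>T_group\<^esub> inv\<^bsub>T_group\<^esub> k \<in> dihedral_at n"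
    and y: "y \<in> carrier T_group" "y \<otimes>\<^bsub>T_group\<^esub> inv\<^bsub>T_group\<^esub> k' \<in> dihedral_at n"
    using assms(1,2) by (auto simp: coset_of_def)
  have kk: "k \<otimes>\<^bsub>T_group\<^esub> inv\<^bsub>T_group\<^esub> k' \<in> dihedral_at n"
    using trans[OF assms(3) x(1) assms(4) sym[OF x(1) assms(3) x(2)]
        trans[OF x(1) y(1) assms(4) xy y(2)]] .
  show ?thesis
    using trans[OF _ assms(3,4) _ kk] trans[OF _ assms(4,3) _ sym[OF assms(3,4) kk]]
    by (auto simp: coset_of_def)
qed

text \<open>For \<open>x\<close> and \<open>y\<close> in a coset, \<open>b = x y\<^sup>-\<^sup>1\<close> lies in \<open>T \<inter> M\<^sub>n\<close>, whatever the coset is. By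
  \<open>coord_comp\<close> the coordinates of \<open>x\<close> and \<open>y\<close> differ by those of \<open>b\<close>. If
  the distance \<open>l b\<close> is bounded, then there are finitely many \<open>b\<close> because \<open>l\<close> is proper; if the
  differences of coordinates are bounded, then by \<open>finite_bounded_coord\<close>. Sums over these
  finite sets serve as control functions.\<close>

lemma coset_coarse_embedding:
  assumes pl: "proper_length T_group l"
  shows "\<exists>S B. \<forall>k\<in>carrier T_group. coarse_embedding (length_metric T_group l) {w. length w = n} S B
           (coset_of n k) (\<lambda>w g. coord w (g \<otimes>\<^bsub>T_group\<^esub> inv\<^bsub>T_group\<^esub> k))"
proof -
  interpret group T_group by (rule T_group_group)
  have lf: "length_function T_group l" and fin: "finite {g \<in> carrier T_group. l g \<le> r}" for r
    using pl by (auto simp: proper_length_def)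
  have l0: "0 \<le> l g" if "g \<in> carrier T_group" for g using lf that by (auto simp: length_function_def)
  let ?W = "{w :: word. length w = n}"
  let ?ball = "\<lambda>r. {g \<in> carrier T_group. l g \<le> r}"
  let ?E = "\<lambda>L. {b \<in> carrier T_group. b \<in> dihedral_at n \<and> (\<forall>v. length v = n \<longrightarrow> \<bar>coord v b\<bar> \<le> L)}"
  define S where "S r = (\<Sum>b\<in>?ball r. \<Sum>v\<in>?W. \<bar>coord v b\<bar>)" for r
  define B where "B L = (\<Sum>b\<in>?E L. l b)" for L
  have "finite (?E L)" for L by (rule finite_subset[OF _ finite_bounded_coord[of n L]]) auto
  then have B: "l b \<le> B L" if "b \<in> ?E L" for b L
    unfolding B_def using that by (intro member_le_sum) (auto simp: l0)
  have S: "\<bar>coord v b\<bar> \<le> S r" if "b \<in> ?ball r" "length v = n" for b v r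
  proof -
    have "\<bar>coord v b\<bar> \<le> (\<Sum>v\<in>?W. \<bar>coord v b\<bar>)"
      using that by (intro member_le_sum) (auto simp: finite_words)
    also have "\<dots> \<le> S r"
      unfolding S_def using that fin[of r]
      by (intro member_le_sum[where f = "\<lambda>b. \<Sum>v\<in>?W. \<bar>coord v b\<bar>"]) (auto intro: sum_nonneg)
    finally show ?thesis .
  qed
  have "coarse_embedding (length_metric T_group l) ?W S B (coset_of n k)
      (\<lambda>w g. coord w (g \<otimes>\<^bsub>T_group\<^esub> inv\<^bsub>T_group\<^esub> k))" if k: "k \<in> carrier T_group" for k
  proof -
    let ?q = "\<lambda>g. g \<otimes>\<^bsub>T_group\<^esub> inv\<^bsub>T_group\<^esub> k"
    have main: "mdist (length_metric T_group l) x y = l (x \<otimes>\<^bsub>T_group\<^esub> inv\<^bsub>T_group\<^esub> y)"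
        "x \<otimes>\<^bsub>T_group\<^esub> inv\<^bsub>T_group\<^esub> y \<in> carrier T_group"
        "x \<otimes>\<^bsub>T_group\<^esub> inv\<^bsub>T_group\<^esub> y \<in> dihedral_at n" "?q y \<in> dihedral_at n"
        "length v = n \<Longrightarrow> \<bar>coord (?q y v) (?q x) - coord (?q y v) (?q y)\<bar>
           = \<bar>coord v (x \<otimes>\<^bsub>T_group\<^esub> inv\<^bsub>T_group\<^esub> y)\<bar>"
      if x: "x \<in> coset_of n k" and y: "y \<in> coset_of n k" for x y v
    proof -
      let ?b = "x \<otimes>\<^bsub>T_group\<^esub> inv\<^bsub>T_group\<^esub> y"
      have c: "x \<in> carrier T_group" "y \<in> carrier T_group" using x y by (auto simp: coset_of_def)
      show q: "?q y \<in> dihedral_at n" using y by (simp add: coset_of_def)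
      show b: "?b \<in> dihedral_at n" by (rule quotient_in_dihedral_at[OF x y k])
      show "mdist (length_metric T_group l) x y = l ?b"
        by (rule mdist_length_metric[OF T_group_group lf c])
      show "?b \<in> carrier T_group" using c by simp
      assume v: "length v = n"
      have "?q y \<circ> ?b = ?q x" using T_quotient[OF c k] unfolding T_group_mult .
      with coord_comp[OF b q v]
      show "\<bar>coord (?q y v) (?q x) - coord (?q y v) (?q y)\<bar> = \<bar>coord v ?b\<bar>" by (simp only:)
    qed
    show ?thesis
      unfolding coarse_embedding_def
    proof (intro conjI ballI allI impI)
      fix w r x y assume w: "w \<in> ?W" and x: "x \<in> coset_of n k" and y: "y \<in> coset_of n k"
        and d: "mdist (length_metric T_group l) x y \<le> r"
      let ?b = "x \<otimes>\<^bsub>T_group\<^esub> inv\<^bsub>T_group\<^esub> y"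
      note q = main(4)[OF x y]
      obtain v where v: "?q y v = w" using dihedral_at_bij[OF q] by (metis bij_pointE)
      then have len: "length v = n" using dihedral_at_length[OF q, of v] w by simp
      have "?b \<in> ?ball r" using main(1,2)[OF x y] d by simp
      from S[OF this len] show "\<bar>coord w (?q x) - coord w (?q y)\<bar> \<le> S r"
        using main(5)[OF x y len] unfolding v by simp
    next
      fix L x y assume x: "x \<in> coset_of n k" and y: "y \<in> coset_of n k"
        and d: "\<forall>w\<in>?W. \<bar>coord w (?q x) - coord w (?q y)\<bar> \<le> L"
      let ?b = "x \<otimes>\<^bsub>T_group\<^esub> inv\<^bsub>T_group\<^esub> y"
      have "\<bar>coord v ?b\<bar> \<le> L" if v: "length v = n" for v
      proof -
        have "?q y v \<in> ?W" using dihedral_at_length[OF main(4)[OF x y], of v] v by simp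
        with d have "\<bar>coord (?q y v) (?q x) - coord (?q y v) (?q y)\<bar> \<le> L" by (rule bspec)
        then show ?thesis unfolding main(5)[OF x y v] .
      qed
      then have "?b \<in> ?E L" using main(2,3)[OF x y] by simp
      from B[OF this] show "mdist (length_metric T_group l) x y \<le> B L"
        unfolding main(1)[OF x y] .
    qed
  qed
  then show ?thesis by (intro exI ballI)
qed

theorem theorem4p10:
  fixes l :: "(word \<Rightarrow> word) \<Rightarrow> real"
  assumes "proper_length T_group l"
  shows "finite_decomposition_complexity (length_metric T_group l) \<and>
         decomposition_class natLeq {length_metric T_group l}"
proof -
  interpret group T_group by (rule T_group_group)
  let ?M = "length_metric T_group l"
  have lf: "length_function T_group l" and fin: "finite {g \<in> carrier T_group. l g \<le> r}" for r
    using assms by (auto simp: proper_length_def)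
  have space: "mspace ?M = carrier T_group" by (rule mspace_length_metric[OF T_group_group lf])
  have "decomposition_class natLeq {?M}"
    unfolding decomposition_class_omega
  proof (intro allI impI)
    fix r :: real
    let ?ball = "{g \<in> carrier T_group. l g \<le> r + 1}"
    obtain \<nu> where \<nu>: "\<And>g. g \<in> carrier T_group \<Longrightarrow> g \<in> dihedral_at (\<nu> g)"
      using T_dihedral_at by metis
    define n where "n = Max (insert 0 (\<nu> ` ?ball))"
    have ball: "g \<in> dihedral_at n" if "g \<in> ?ball" for g
    proof -
      have "\<nu> g \<le> n" unfolding n_def using that fin[of "r + 1"] by (intro Max_ge) auto
      then show ?thesis using \<nu>[of g] dihedral_at_mono that by blast
    qed
    let ?W = "{w :: word. length w = n}"
    let ?C = "coset_of n ` carrier T_group"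
    obtain S B where SB: "\<forall>k\<in>carrier T_group. coarse_embedding ?M ?W S B
        (coset_of n k) (\<lambda>w g. coord w (g \<otimes>\<^bsub>T_group\<^esub> inv\<^bsub>T_group\<^esub> k))"
      using coset_coarse_embedding[OF assms] by blast
    have "decomposition_class (natLeq_on (card ?W)) (submetric ?M ` ?C)"
    proof (rule coarse_embedding_decomposition_class)
      show "finite ?W" by (rule finite_words)
      fix U assume "U \<in> ?C"
      then obtain k where k: "k \<in> carrier T_group" "U = coset_of n k" by blast
      then show "U \<subseteq> mspace ?M" by (auto simp: space coset_of_def)
      from SB k show "\<exists>f. coarse_embedding ?M ?W S B U f" by blast
    qed
    moreover have "r_decomposable r {?M} (submetric ?M ` ?C)"
      unfolding r_decomposable_def
    proof
      fix Z assume Z: "Z \<in> {?M}"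
      have "k \<in> coset_of n k" if "k \<in> carrier T_group" for k
        using that dihedral_at_id by (auto simp: coset_of_def T_group_one)
      then have "mspace Z = \<Union>?C" using Z space by (auto simp: coset_of_def)
      moreover have "r_disjoint Z r ?C"
      proof (rule r_disjointI[of r "r + 1"])
        fix U V x y assume "U \<in> ?C" "V \<in> ?C" and xy: "x \<in> U" "y \<in> V" "mdist Z x y \<le> r + 1"
        then obtain k k' where k: "k \<in> carrier T_group" "k' \<in> carrier T_group"
          "U = coset_of n k" "V = coset_of n k'" by blast
        have c: "x \<in> carrier T_group" "y \<in> carrier T_group" using xy k by (auto simp: coset_of_def)
        have "mdist ?M x y \<le> r + 1" using xy(3) Z by simp
        then have "x \<otimes>\<^bsub>T_group\<^esub> inv\<^bsub>T_group\<^esub> y \<in> ?ball"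
          unfolding mdist_length_metric[OF T_group_group lf c] using c by simp
        then have q: "x \<otimes>\<^bsub>T_group\<^esub> inv\<^bsub>T_group\<^esub> y \<in> dihedral_at n" by (rule ball)
        have "x \<in> coset_of n k" "y \<in> coset_of n k'" using xy(1,2) k(3,4) by auto
        from coset_of_eqI[OF this k(1,2) q] show "U = V" unfolding k(3,4) .
      qed simp
      moreover have "r_disjoint Z r {}" by (simp add: r_disjoint_def)
      moreover have "\<forall>U \<in> ?C \<union> {}. submetric Z U \<in> submetric ?M ` ?C" using Z by blast
      ultimately show "\<exists>\<U>\<^sub>0 \<U>\<^sub>1. mspace Z = \<Union>\<U>\<^sub>0 \<union> \<Union>\<U>\<^sub>1 \<and> r_disjoint Z r \<U>\<^sub>0 \<and> r_disjoint Z r \<U>\<^sub>1 \<and>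
          (\<forall>U \<in> \<U>\<^sub>0 \<union> \<U>\<^sub>1. submetric Z U \<in> submetric ?M ` ?C)"
        by (intro exI[of _ ?C] exI[of _ "{}"]) simp
    qed
    ultimately show "\<exists>n G. decomposition_class (natLeq_on n) G \<and> r_decomposable r {?M} G" by blast
  qed
  then show ?thesis using finite_decomposition_complexityI[OF natLeq_Well_order] by blast
qed

end
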